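(* If $\alpha$ is a countable $\Sigma^1_1$-pd ordinal, then $\mathcal{O}^\Box$ clarifies the class $\{\mathfrak{A}:\mathfrak{A}\cong\alpha\}$; that is, for any two structures $\mathfrak{A},\mathfrak{B}$ with domain $\omega$ both isomorphic to $(\alpha,<)$, there is an isomorphism $\mathfrak{A}\cong\mathfrak{B}$ computable from $\mathcal{O}^{\mathfrak{A}}\oplus\mathcal{O}^{\mathfrak{B}}$.
   Context: An ordinal $\alpha$ is $\Sigma^1_1$-pd ($\Sigma^1_1$-pointwise-definable) iff for every $a\in L_\alpha$ there is a $\Sigma^1_1$ formula $\varphi_a(x)\equiv\exists X\,\psi(X,x)$ in the language of set theory, where $\psi$ is first-order (allowing the additional second-order variable $X$) and the quantifier $\exists X$ is a genuine second-order quantifier ranging over all subsets of $L_\alpha$ (not just definable ones), such that $\{x\in L_\alpha: (L_\alpha,\in)\models\varphi_a(x)\}=\{a\}$. Countable structures with domain $\omega$ are identified with (reals coding) their atomic diagrams. For a real $x$, $\mathcal{O}^x$ is Kleene's $\mathcal{O}$ relativized to $x$, the canonical $\Pi^1_1(x)$-complete set of natural numbers; $\mathcal{O}^\Box$ is the functional $x\mapsto\mathcal{O}^x$. *)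

theory Defs
  imports "HOL-Library.Countable_Set_Type" "HOL-Library.Nat_Bijection"
begin

section \<open>Hereditarily countable sets, ordinals and the constructible hierarchy\<close>

text \<open>
  The hereditarily countable sets form a datatype, as \<^typ>\<open>'a cset\<close> is a bounded natural
  functor; two elements are equal iff they have the same members.  The von Neumann ordinals in
  this type are exactly the countable ordinals.
\<close>

datatype hc = HC (members: "hc cset")

definition elts :: "hc \<Rightarrow> hc set" where
  "elts x = rcset (members x)"

lemma countable_elts: "countable (elts x)"
  by (simp add: elts_def)

lemma elts_inject: "elts x = elts y \<longleftrightarrow> x = y"
  by (cases x; cases y) (simp add: elts_def rcset_inject)

lemma ex_elts: "countable A \<Longrightarrow> \<exists>x. elts x = A"
  by (metis acset_inverse elts_def hc.sel mem_Collect_eq)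

definition transitive_set :: "hc \<Rightarrow> bool" where
  "transitive_set x \<longleftrightarrow> (\<forall>y\<in>elts x. elts y \<subseteq> elts x)"

definition is_ordinal :: "hc \<Rightarrow> bool" where
  "is_ordinal x \<longleftrightarrow> transitive_set x \<and> (\<forall>y\<in>elts x. transitive_set y)"

text \<open>
  Formulas of the language of set theory with first-order variables indexed by natural numbers
  and a single unary second-order variable \<open>X\<close>; \<open>In_X i\<close> is the atomic formula
  \<open>v\<^sub>i \<in> X\<close>.  There are no second-order quantifiers.
\<close>

datatype fml =
    Mem nat nat
  | Equal nat nat
  | In_X nat
  | Neg fml
  | Conj fml fml
  | Exists nat fml

primrec free_vars :: "fml \<Rightarrow> nat set" where
  "free_vars (Mem i j) = {i, j}"
| "free_vars (Equal i j) = {i, j}"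
| "free_vars (In_X i) = {i}"
| "free_vars (Neg \<phi>) = free_vars \<phi>"
| "free_vars (Conj \<phi> \<psi>) = free_vars \<phi> \<union> free_vars \<psi>"
| "free_vars (Exists i \<phi>) = free_vars \<phi> - {i}"

primrec X_free :: "fml \<Rightarrow> bool" where
  "X_free (Mem i j) = True"
| "X_free (Equal i j) = True"
| "X_free (In_X i) = False"
| "X_free (Neg \<phi>) = X_free \<phi>"
| "X_free (Conj \<phi> \<psi>) = (X_free \<phi> \<and> X_free \<psi>)"
| "X_free (Exists i \<phi>) = X_free \<phi>"

text \<open>Satisfaction in the structure \<open>(M, \<in>)\<close>, with \<open>X\<close> interpreting the second-order variable.\<close>

primrec sat :: "hc set \<Rightarrow> hc set \<Rightarrow> (nat \<Rightarrow> hc) \<Rightarrow> fml \<Rightarrow> bool" where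
  "sat M X e (Mem i j) \<longleftrightarrow> e i \<in> elts (e j)"
| "sat M X e (Equal i j) \<longleftrightarrow> e i = e j"
| "sat M X e (In_X i) \<longleftrightarrow> e i \<in> X"
| "sat M X e (Neg \<phi>) \<longleftrightarrow> \<not> sat M X e \<phi>"
| "sat M X e (Conj \<phi> \<psi>) \<longleftrightarrow> sat M X e \<phi> \<and> sat M X e \<psi>"
| "sat M X e (Exists i \<phi>) \<longleftrightarrow> (\<exists>a\<in>M. sat M X (e(i := a)) \<phi>)"

text \<open>
  The subsets of \<open>M\<close> that are first-order definable over \<open>(M, \<in>)\<close> with parameters, as elements
  of \<^typ>\<open>hc\<close>.  Variable \<open>0\<close> is the defining variable and the other free variables hold the
  parameters; the values of \<open>e\<close> elsewhere are irrelevant, so that \<open>Def {}\<close> contains the empty set.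
  The interpretation of \<open>X\<close> is irrelevant for \<open>X\<close>-free formulas.
\<close>

definition Def :: "hc set \<Rightarrow> hc set" where
  "Def M = {x. \<exists>\<phi> e. X_free \<phi> \<and> (\<forall>i\<in>free_vars \<phi> - {0}. e i \<in> M)
                  \<and> elts x = {a\<in>M. sat M {} (e(0 := a)) \<phi>}}"

primrec L :: "hc \<Rightarrow> hc set" where
  "L (HC A) = (\<Union>M\<in>rcset (cimage L A). Def M)"

lemma L_unfold: "L \<alpha> = (\<Union>\<beta>\<in>elts \<alpha>. Def (L \<beta>))"
  by (cases \<alpha>) (simp add: elts_def cimage.rep_eq)

instance fml :: countable by countable_datatype

lemma sat_cong: "(\<And>i. i \<in> free_vars \<phi> \<Longrightarrow> e i = e' i) \<Longrightarrow> sat M X e \<phi> = sat M X e' \<phi>"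
proof (induction \<phi> arbitrary: e e')
  case (Exists i \<phi>)
  have "sat M X (e(i := a)) \<phi> = sat M X (e'(i := a)) \<phi>" for a
    by (rule Exists.IH) (use Exists.prems in auto)
  then show ?case by simp
next
  case (Neg \<phi>) then show ?case by (metis free_vars.simps(4) sat.simps(4))
next
  case (Conj \<phi> \<psi>) then show ?case by (metis free_vars.simps(5) sat.simps(5) UnI1 UnI2)
qed auto

lemma finite_free_vars: "finite (free_vars \<phi>)" by (induction \<phi>) auto

lemma countable_Def: assumes "countable M" shows "countable (Def M)"
proof -
  define env where "env ps i = (if i < length ps then ps ! i else HC cempty)" for ps :: "hc list" and i
  define D where "D = (\<lambda>(\<phi>, ps). {a\<in>M. sat M {} ((env ps)(0 := a)) \<phi>})"
  have "elts ` Def M \<subseteq> D ` (UNIV \<times> lists (insert (HC cempty) M))"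
  proof clarify
    fix x assume "x \<in> Def M"
    then obtain \<phi> e where e: "\<forall>i\<in>free_vars \<phi> - {0}. e i \<in> M"
      and x: "elts x = {a\<in>M. sat M {} (e(0 := a)) \<phi>}" unfolding Def_def by blast
    obtain n where n: "free_vars \<phi> \<subseteq> {..<n}"
      using finite_nat_bounded[OF finite_free_vars] by blast
    define ps where "ps = map (\<lambda>i. if e i \<in> M then e i else HC cempty) [0..<n]"
    have "sat M {} ((env ps)(0 := a)) \<phi> = sat M {} (e(0 := a)) \<phi>" for a
      by (rule sat_cong) (use n e in \<open>auto simp: env_def ps_def\<close>)
    then have "elts x = D (\<phi>, ps)" by (simp add: D_def x)
    moreover have "ps \<in> lists (insert (HC cempty) M)" by (auto simp: ps_def)
    ultimately show "elts x \<in> D ` (UNIV \<times> lists (insert (HC cempty) M))" by blast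
  qed
  moreover have "countable (D ` (UNIV \<times> lists (insert (HC cempty) M)))"
    using assms by (intro countable_image countable_SIGMA countable_lists) auto
  ultimately have "countable (elts ` Def M)" by (rule countable_subset)
  then show ?thesis by (rule countable_image_inj_on) (auto simp: inj_on_def elts_inject)
qed

text \<open>
  All levels are countable, so \<open>Def\<close> loses no definable subset of a level by only collecting
  hereditarily countable sets.
\<close>

lemma countable_L: "countable (L \<alpha>)"
proof (induction \<alpha>)
  case (HC A)
  then show ?case
    using countable_elts[of "hc.HC A"] by (auto simp: L_unfold[of "hc.HC A"] elts_def countable_Def simp del: L.simps)
qed

text \<open>
  The \<open>\<Sigma>\<^sup>1\<^sub>1\<close> formula \<open>\<exists>X. \<psi>(X, v\<^sub>0)\<close> holds of \<open>a\<close> in \<open>(M, \<in>)\<close>, where \<open>X\<close> ranges over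
  all subsets of \<open>M\<close>.  It is meant for \<open>\<psi>\<close> with no free first-order variable other than \<open>0\<close>.
\<close>

definition sat_Sigma11 :: "hc set \<Rightarrow> fml \<Rightarrow> hc \<Rightarrow> bool" where
  "sat_Sigma11 M \<psi> a \<longleftrightarrow> (\<exists>X. X \<subseteq> M \<and> sat M X (\<lambda>_. a) \<psi>)"

definition Sigma11_pd :: "hc \<Rightarrow> bool" where
  "Sigma11_pd \<alpha> \<longleftrightarrow>
     (\<forall>a\<in>L \<alpha>. \<exists>\<psi>. free_vars \<psi> \<subseteq> {0} \<and> {x\<in>L \<alpha>. sat_Sigma11 (L \<alpha>) \<psi> x} = {a})"


section \<open>Oracle computability\<close>

text \<open>
  Programs for unary partial recursive functions relative to an oracle; several arguments are
  passed through the pairing function \<^const>\<open>prod_encode\<close>.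
\<close>

datatype prog =
    Zero
  | Succ
  | Proj1
  | Proj2
  | Oracle
  | Pairing prog prog
  | Comp prog prog
  | PrimRec prog prog
  | Mu prog

primrec run :: "nat set \<Rightarrow> prog \<Rightarrow> nat \<Rightarrow> nat option" where
  "run A Zero n = Some 0"
| "run A Succ n = Some (Suc n)"
| "run A Proj1 n = Some (fst (prod_decode n))"
| "run A Proj2 n = Some (snd (prod_decode n))"
| "run A Oracle n = Some (if n \<in> A then 1 else 0)"
| "run A (Pairing p q) n =
     Option.bind (run A p n) (\<lambda>a. Option.bind (run A q n) (\<lambda>b. Some (prod_encode (a, b))))"
| "run A (Comp p q) n = Option.bind (run A q n) (run A p)"
| "run A (PrimRec p q) n =
     (let (a, k) = prod_decode n in
      rec_nat (run A p a)
        (\<lambda>i r. Option.bind r (\<lambda>v. run A q (prod_encode (a, prod_encode (i, v))))) k)"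
| "run A (Mu p) n =
     (if \<exists>m. run A p (prod_encode (n, m)) = Some 0
             \<and> (\<forall>k<m. \<exists>v>0. run A p (prod_encode (n, k)) = Some v)
      then Some (LEAST m. run A p (prod_encode (n, m)) = Some 0)
      else None)"

definition computable_from :: "(nat \<Rightarrow> nat) \<Rightarrow> nat set \<Rightarrow> bool" where
  "computable_from f A \<longleftrightarrow> (\<exists>p. \<forall>n. run A p n = Some (f n))"

text \<open>A Goedel numbering of the programs; every number is the index of exactly one program.\<close>

primrec prog_index :: "prog \<Rightarrow> nat" where
  "prog_index Zero = 0"
| "prog_index Succ = 1"
| "prog_index Proj1 = 2"
| "prog_index Proj2 = 3"
| "prog_index Oracle = 4"
| "prog_index (Pairing p q) = 5 + 4 * prod_encode (prog_index p, prog_index q)"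
| "prog_index (Comp p q) = 6 + 4 * prod_encode (prog_index p, prog_index q)"
| "prog_index (PrimRec p q) = 7 + 4 * prod_encode (prog_index p, prog_index q)"
| "prog_index (Mu p) = 8 + 4 * prog_index p"

lemma prog_index_inject: "prog_index p = prog_index q \<Longrightarrow> p = q"
proof (induction p arbitrary: q)
  case (Pairing p1 p2) then show ?case by (cases q) (simp_all, presburger+)
next
  case (Comp p1 p2) then show ?case by (cases q) (simp_all, presburger+)
next
  case (PrimRec p1 p2) then show ?case by (cases q) (simp_all, presburger+)
next
  case (Mu p) then show ?case by (cases q) (simp_all, presburger+)
next
qed (case_tac q; simp)+

lemma prog_index_surj: "\<exists>p. prog_index p = n"
proof (induction n rule: less_induct)
  case (less n)
  show ?case
  proof (cases "n < 5")
    case True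
    then have "n = 0 \<or> n = 1 \<or> n = 2 \<or> n = 3 \<or> n = 4" by linarith
    then show ?thesis by (metis prog_index.simps(1-5))
  next
    case False
    define m where "m = (n - 5) div 4"
    obtain a b where ab: "m = prod_encode (a, b)"
      by (metis surj_pair prod_decode_inverse)
    have "m < n"
      using False by (simp add: m_def)
    moreover have "a \<le> m" "b \<le> m"
      unfolding ab by (rule le_prod_encode_1, rule le_prod_encode_2)
    ultimately obtain p q r where p: "prog_index p = a" "prog_index q = b" "prog_index r = m"
      using less.IH by (meson le_less_trans)
    have "n = 5 + 4 * m \<or> n = 6 + 4 * m \<or> n = 7 + 4 * m \<or> n = 8 + 4 * m"
      using False unfolding m_def by presburger
    then show ?thesis using p ab by (metis prog_index.simps(6-9))
  qed
qed

lemma bij_prog_index: "bij prog_index"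
  by (metis bijI' prog_index_inject prog_index_surj)

definition index_run :: "nat set \<Rightarrow> nat \<Rightarrow> nat \<Rightarrow> nat option" where
  "index_run A e = run A (inv prog_index e)"

definition join :: "nat set \<Rightarrow> nat set \<Rightarrow> nat set" where
  "join A B = {2 * n | n. n \<in> A} \<union> {2 * n + 1 | n. n \<in> B}"


section \<open>Relativized Kleene's O\<close>

inductive in_O :: "nat set \<Rightarrow> nat \<Rightarrow> bool" and less_O :: "nat set \<Rightarrow> nat \<Rightarrow> nat \<Rightarrow> bool"
  for x :: "nat set" where
  zero: "in_O x 1"
| suc: "in_O x a \<Longrightarrow> in_O x (2 ^ a)"
| lim: "\<lbrakk>\<And>n. index_run x e n = Some (f n); \<And>n. in_O x (f n); \<And>n. less_O x (f n) (f (Suc n))\<rbrakk>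
        \<Longrightarrow> in_O x (3 * 5 ^ e)"
| less_suc: "in_O x a \<Longrightarrow> less_O x a (2 ^ a)"
| less_lim: "\<lbrakk>\<And>n. index_run x e n = Some (f n); \<And>n. in_O x (f n);
              \<And>n. less_O x (f n) (f (Suc n))\<rbrakk>
             \<Longrightarrow> less_O x (f m) (3 * 5 ^ e)"
| less_trans: "\<lbrakk>less_O x a b; less_O x b c\<rbrakk> \<Longrightarrow> less_O x a c"

definition Kleene_O :: "nat set \<Rightarrow> nat set" where
  "Kleene_O x = {a. in_O x a}"


section \<open>Structures with domain \<open>\<omega>\<close> and clarification\<close>

text \<open>
  A structure with domain \<open>\<omega>\<close> in the language of orders is given by its order relation.  Its
  atomic diagram is the set of codes of the atomic sentences that hold in it: \<open>i < j\<close> has code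
  \<open>2 \<langle>i, j\<rangle>\<close> and \<open>i = j\<close> has code \<open>2 \<langle>i, j\<rangle> + 1\<close>.
\<close>

type_synonym omega_structure = "(nat \<times> nat) set"

definition atomic_diagram :: "omega_structure \<Rightarrow> nat set" where
  "atomic_diagram R =
     {2 * prod_encode (i, j) | i j. (i, j) \<in> R} \<union> {2 * prod_encode (i, j) + 1 | i j. i = j}"

definition isomorphism :: "(nat \<Rightarrow> nat) \<Rightarrow> omega_structure \<Rightarrow> omega_structure \<Rightarrow> bool" where
  "isomorphism f R S \<longleftrightarrow> bij f \<and> (\<forall>i j. (i, j) \<in> R \<longleftrightarrow> (f i, f j) \<in> S)"

text \<open>The order of a von Neumann ordinal is membership.\<close>

definition isomorphic_to_ordinal :: "omega_structure \<Rightarrow> hc \<Rightarrow> bool" where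
  "isomorphic_to_ordinal R \<alpha> \<longleftrightarrow>
     (\<exists>g. bij_betw g UNIV (elts \<alpha>) \<and> (\<forall>i j. (i, j) \<in> R \<longleftrightarrow> g i \<in> elts (g j)))"

definition clarifies :: "(nat set \<Rightarrow> nat set) \<Rightarrow> omega_structure set \<Rightarrow> bool" where
  "clarifies F \<K> \<longleftrightarrow>
     (\<forall>R\<in>\<K>. \<forall>S\<in>\<K>. \<exists>f. isomorphism f R S
        \<and> computable_from f (join (F (atomic_diagram R)) (F (atomic_diagram S))))"

end

theory Submission
  imports Defs
begin

text \<open>
  Let \<open>R\<close> be a copy of \<open>\<alpha>\<close>. Every element of \<open>L\<^sub>\<alpha>\<close> has a name built from an element of \<open>R\<close>, a formula
  and names of lower levels. Truth of the statements \<open>\<exists>X. \<psi>(X, v)\<close> over \<open>L\<^sub>\<alpha>\<close> is then the existence of a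
  truth assignment, with witnesses, that obeys a system of local conditions computable in \<open>R\<close>: as
  \<open>R\<close> is well-ordered, the conditions determine the truth values of everything but the atoms about \<open>X\<close>.
  The finite attempts at such an assignment form a tree computable in \<open>R\<close>; its
  Kleene-Brouwer order is well-founded iff there is no assignment, and initial segments of a
  computable linear order have notations that are in \<open>\<O>\<^sup>R\<close> iff the segment is well-founded.

  So \<open>\<O>\<^sup>R\<close> decides whether \<open>\<psi>\<close> holds of an ordinal, and whether it holds of another one. To find the
  image of \<open>n\<close>, search for a \<open>\<psi>\<close> that defines the ordinal of \<open>n\<close> in \<open>R\<close>, and for an element
  of the other copy of which \<open>\<psi>\<close> holds.
\<close>

section \<open>Functions computable uniformly in an oracle\<close>

abbreviation pr1 :: "nat \<Rightarrow> nat" where "pr1 n \<equiv> fst (prod_decode n)"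
abbreviation pr2 :: "nat \<Rightarrow> nat" where "pr2 n \<equiv> snd (prod_decode n)"

text \<open>One program serves all oracles. This uniformity later gives a single reduction to
  \<open>Kleene_O\<close> that works for both copies and whose values do not depend on the
  oracle.\<close>

definition computable :: "(nat set \<Rightarrow> nat \<Rightarrow> nat) \<Rightarrow> bool" where
  "computable F \<longleftrightarrow> (\<exists>p. \<forall>A n. run A p n = Some (F A n))"

definition decidable :: "(nat set \<Rightarrow> nat \<Rightarrow> bool) \<Rightarrow> bool" where
  "decidable P \<longleftrightarrow> computable (\<lambda>A n. if P A n then 1 else 0)"

named_theorems comp_intros

lemma computable_id [comp_intros]: "computable (\<lambda>A n. n)"
  unfolding computable_def by (rule exI[of _ "Pairing Proj1 Proj2"]) simp

lemma computable_Suc [comp_intros]: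
  assumes "computable f" shows "computable (\<lambda>A n. Suc (f A n))"
proof -
  obtain p where "\<And>A n. run A p n = Some (f A n)" using assms computable_def by auto
  then have "\<And>A n. run A (Comp Succ p) n = Some (Suc (f A n))" by simp
  then show ?thesis unfolding computable_def by blast
qed

lemma computable_const [comp_intros]: "computable (\<lambda>A n. c)"
proof (induction c)
  case 0
  have "\<And>A n. run A Zero n = Some 0" by simp
  then show ?case unfolding computable_def by blast
qed (rule computable_Suc)

lemma computable_comp:
  assumes "computable f" "computable h" shows "computable (\<lambda>A n. h A (f A n))"
proof -
  obtain p q where "\<And>A n. run A p n = Some (f A n)" "\<And>A n. run A q n = Some (h A n)"
    using assms computable_def by auto
  then have "\<And>A n. run A (Comp q p) n = Some (h A (f A n))" by simp
  then show ?thesis unfolding computable_def by blast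
qed

lemma computable_pair [comp_intros]:
  assumes "computable f" "computable g"
  shows "computable (\<lambda>A n. prod_encode (f A n, g A n))"
proof -
  obtain p q where "\<And>A n. run A p n = Some (f A n)" "\<And>A n. run A q n = Some (g A n)"
    using assms computable_def by auto
  then have "\<And>A n. run A (Pairing p q) n = Some (prod_encode (f A n, g A n))" by simp
  then show ?thesis unfolding computable_def by blast
qed

text \<open>Curried functions are handled through pair codes; the four substitution rules from here
  on let the syntax of a term drive its computability proof.\<close>

lemma computable_comp2:
  assumes "computable (\<lambda>A m. h A (pr1 m) (pr2 m))" "computable f" "computable g"
  shows "computable (\<lambda>A n. h A (f A n) (g A n))"
  using computable_comp[OF computable_pair[OF assms(2,3)] assms(1)] by simp

lemma computable_comp3:
  assumes "computable (\<lambda>A m. h A (pr1 m) (pr1 (pr2 m)) (pr2 (pr2 m)))"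
    "computable f" "computable g" "computable k"
  shows "computable (\<lambda>A n. h A (f A n) (g A n) (k A n))"
  using computable_comp[OF computable_pair[OF assms(2) computable_pair[OF assms(3,4)]] assms(1)]
  by simp

lemma decidable_comp2:
  assumes "decidable (\<lambda>A m. P A (pr1 m) (pr2 m))" "computable f" "computable g"
  shows "decidable (\<lambda>A n. P A (f A n) (g A n))"
  using assms computable_comp2[of "\<lambda>A x y. if P A x y then 1 else 0" f g]
  by (simp add: decidable_def)

lemma decidable_comp3:
  assumes "decidable (\<lambda>A m. P A (pr1 m) (pr1 (pr2 m)) (pr2 (pr2 m)))"
    "computable f" "computable g" "computable k"
  shows "decidable (\<lambda>A n. P A (f A n) (g A n) (k A n))"
  using assms computable_comp3[of "\<lambda>A x y z. if P A x y z then 1 else 0" f g k]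
  by (simp add: decidable_def)

lemma computable_pr1 [comp_intros]:
  assumes "computable f" shows "computable (\<lambda>A n. pr1 (f A n))"
proof -
  have "\<And>A n. run A Proj1 n = Some (pr1 n)" by simp
  then have "computable (\<lambda>A. pr1)" unfolding computable_def by blast
  then show ?thesis by (rule computable_comp[OF assms])
qed

lemma computable_pr2 [comp_intros]:
  assumes "computable f" shows "computable (\<lambda>A n. pr2 (f A n))"
proof -
  have "\<And>A n. run A Proj2 n = Some (pr2 n)" by simp
  then have "computable (\<lambda>A. pr2)" unfolding computable_def by blast
  then show ?thesis by (rule computable_comp[OF assms])
qed

lemma computable_rec [comp_intros]:
  assumes "computable a" "computable k"
    and "computable (\<lambda>A m. h A (pr1 m) (pr1 (pr2 m)) (pr2 (pr2 m)))"
  shows "computable (\<lambda>A n. rec_nat (a A n) (\<lambda>i r. h A n i r) (k A n))"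
proof -
  obtain p q where p: "\<And>A n. run A p n = Some (a A n)"
    and q: "\<And>A m. run A q m = Some (h A (pr1 m) (pr1 (pr2 m)) (pr2 (pr2 m)))"
    using assms computable_def by auto
  have "run A (PrimRec p q) m = Some (rec_nat (a A (pr1 m)) (\<lambda>i r. h A (pr1 m) i r) (pr2 m))" for A m
  proof -
    have "rec_nat (run A p x) (\<lambda>i r. Option.bind r (\<lambda>v. run A q (prod_encode (x, prod_encode (i, v))))) y
      = Some (rec_nat (a A x) (\<lambda>i r. h A x i r) y)" for x y
      by (induction y) (simp_all add: p q)
    then show ?thesis by (simp add: case_prod_beta)
  qed
  then have "computable (\<lambda>A m. rec_nat (a A (pr1 m)) (\<lambda>i r. h A (pr1 m) i r) (pr2 m))"
    unfolding computable_def by blast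
  then show ?thesis
    by (rule computable_comp2[where h = "\<lambda>A x y. rec_nat (a A x) (\<lambda>i r. h A x i r) y",
          OF _ computable_id assms(2)])
qed

lemma decidable_zero:
  assumes "computable f" shows "decidable (\<lambda>A n. f A n = 0)"
proof -
  have "computable (\<lambda>A n. rec_nat 1 (\<lambda>i r. 0) (f A n))"
    by (intro comp_intros assms)
  also have "(\<lambda>A n. rec_nat 1 (\<lambda>i r. 0) (f A n)) = (\<lambda>A n. if f A n = 0 then 1 else 0 :: nat)"
  proof (intro ext)
    show "rec_nat 1 (\<lambda>i r. 0) (f A n) = (if f A n = 0 then 1 else 0 :: nat)" for A n
      by (cases "f A n") auto
  qed
  finally show ?thesis by (simp add: decidable_def)
qed

lemma computable_if [comp_intros]:
  assumes "decidable P" "computable f" "computable g"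
  shows "computable (\<lambda>A n. if P A n then f A n else g A n)"
proof -
  \<comment> \<open>A recursion that runs zero or one times selects the branch.\<close>
  have "computable (\<lambda>A n. rec_nat (g A n) (\<lambda>i r. f A n) (if P A n then 1 else 0))"
    by (intro comp_intros assms assms[unfolded decidable_def] computable_comp[OF _ assms(2)])
  also have "(\<lambda>A n. rec_nat (g A n) (\<lambda>i r. f A n) (if P A n then 1 else 0))
      = (\<lambda>A n. if P A n then f A n else g A n)"
    by (intro ext) auto
  finally show ?thesis .
qed

lemma decidable_not [comp_intros]:
  assumes "decidable P" shows "decidable (\<lambda>A n. \<not> P A n)"
proof -
  have "computable (\<lambda>A n. if P A n then 0 else 1)" by (intro comp_intros assms)
  moreover have "(\<lambda>A n. if P A n then 0 else 1 :: nat) = (\<lambda>A n. if \<not> P A n then 1 else 0)"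
    by (intro ext) auto
  ultimately show ?thesis by (simp add: decidable_def)
qed

lemma decidable_conj [comp_intros]:
  assumes "decidable P" "decidable Q" shows "decidable (\<lambda>A n. P A n \<and> Q A n)"
proof -
  have "computable (\<lambda>A n. if P A n then if Q A n then 1 else 0 else 0)"
    by (intro comp_intros assms)
  moreover have "(\<lambda>A n. if P A n then if Q A n then 1 else 0 else 0 :: nat)
     = (\<lambda>A n. if P A n \<and> Q A n then 1 else 0)"
    by (intro ext) auto
  ultimately show ?thesis by (simp add: decidable_def)
qed

lemma decidable_disj [comp_intros]:
  assumes "decidable P" "decidable Q" shows "decidable (\<lambda>A n. P A n \<or> Q A n)"
  using decidable_not[OF decidable_conj[OF assms[THEN decidable_not]]] by simp

lemma decidable_imp [comp_intros]:
  assumes "decidable P" "decidable Q" shows "decidable (\<lambda>A n. P A n \<longrightarrow> Q A n)"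
  using decidable_disj[OF decidable_not[OF assms(1)] assms(2)] by simp

lemma decidable_ball [comp_intros]:
  assumes "computable k" "decidable (\<lambda>A m. P A (pr1 m) (pr2 m))"
  shows "decidable (\<lambda>A n. \<forall>i<k A n. P A n i)"
proof -
  have "decidable (\<lambda>A m. P A (pr1 m) (pr1 (pr2 m)))"
    by (rule decidable_comp2[where P = P, OF assms(2)]) (intro comp_intros)+
  then have "computable (\<lambda>A n. rec_nat 1 (\<lambda>i r. if P A n i then r else 0) (k A n))"
    by (intro comp_intros assms(1))
  moreover have "rec_nat 1 (\<lambda>i r. if P A n i then r else 0) m = (if \<forall>i<m. P A n i then 1 else 0 :: nat)"
    for A n m by (induction m) (auto simp: less_Suc_eq)
  ultimately show ?thesis by (simp add: decidable_def)
qed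

lemma decidable_bex [comp_intros]:
  assumes "computable k" "decidable (\<lambda>A m. P A (pr1 m) (pr2 m))"
  shows "decidable (\<lambda>A n. \<exists>i<k A n. P A n i)"
  using decidable_not[OF decidable_ball[where P = "\<lambda>A n i. \<not> P A n i", OF assms(1) decidable_not[OF assms(2)]]] by simp

section \<open>Arithmetic, division by constants and iteration\<close>

lemma computable_add [comp_intros]:
  assumes "computable f" "computable g" shows "computable (\<lambda>A n. f A n + g A n)"
proof -
  have "computable (\<lambda>A n. rec_nat (f A n) (\<lambda>i r. Suc r) (g A n))"
    by (intro comp_intros assms)
  moreover have "rec_nat x (\<lambda>i r. Suc r) y = x + y" for x y by (induction y) auto
  ultimately show ?thesis by simp
qed

lemma computable_mult [comp_intros]:
  assumes "computable f" "computable g" shows "computable (\<lambda>A n. f A n * g A n)"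
proof -
  have "computable (\<lambda>A n. rec_nat 0 (\<lambda>i r. r + f A n) (g A n))"
    by (intro comp_intros assms computable_comp[OF _ assms(1)])
  moreover have "rec_nat 0 (\<lambda>i r. r + x) y = x * y" for x y :: nat by (induction y) auto
  ultimately show ?thesis by simp
qed

lemma computable_power [comp_intros]:
  assumes "computable f" "computable g" shows "computable (\<lambda>A n. f A n ^ g A n)"
proof -
  have "computable (\<lambda>A n. rec_nat 1 (\<lambda>i r. f A n * r) (g A n))"
    by (intro comp_intros assms computable_comp[OF _ assms(1)])
  moreover have "rec_nat 1 (\<lambda>i r. x * r) y = x ^ y" for x y :: nat by (induction y) auto
  ultimately show ?thesis by simp
qed

lemma computable_diff [comp_intros]:
  assumes "computable f" "computable g" shows "computable (\<lambda>A n. f A n - g A n)"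
proof -
  \<comment> \<open>The inner recursion returns its last counter, so it is the predecessor;
    iterating it gives truncated subtraction.\<close>
  have "computable (\<lambda>A n. rec_nat (f A n) (\<lambda>i r. rec_nat 0 (\<lambda>j s. j) r) (g A n))"
    by (intro comp_intros assms)
  moreover have "rec_nat 0 (\<lambda>j s. j) z = z - 1" for z :: nat by (cases z) auto
  then have "rec_nat x (\<lambda>i r. rec_nat 0 (\<lambda>j s. j) r) y = x - y" for x y :: nat
    by (induction y) auto
  ultimately show ?thesis by simp
qed

lemma decidable_le [comp_intros]:
  assumes "computable f" "computable g" shows "decidable (\<lambda>A n. f A n \<le> g A n)"
  using decidable_zero[OF computable_diff[OF assms]] by simp

lemma decidable_less [comp_intros]:
  assumes "computable f" "computable g" shows "decidable (\<lambda>A n. f A n < g A n)"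
  using decidable_not[OF decidable_le[OF assms(2,1)]] by (simp add: not_le)

lemma decidable_eq [comp_intros]:
  assumes "computable f" "computable g" shows "decidable (\<lambda>A n. f A n = g A n)"
  using decidable_conj[OF decidable_le[OF assms] decidable_le[OF assms(2,1)]]
  by (simp add: eq_iff)

lemma decidable_member [comp_intros]:
  assumes "computable f" shows "decidable (\<lambda>A n. f A n \<in> A)"
proof -
  have "\<And>A n. run A Oracle n = Some (if n \<in> A then 1 else 0)" by simp
  then have "computable (\<lambda>A n. if n \<in> A then 1 else 0)" unfolding computable_def by blast
  then show ?thesis unfolding decidable_def by (rule computable_comp[OF assms])
qed

lemma computable_mod [comp_intros]:
  assumes "computable f" shows "computable (\<lambda>A n. f A n mod d)"
proof (cases d)
  case 0
  then show ?thesis using assms by simp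
next
  case (Suc d')
  have "computable (\<lambda>A n. rec_nat 0 (\<lambda>i r. if Suc r = d then 0 else Suc r) (f A n))"
    by (intro comp_intros assms)
  moreover have "rec_nat 0 (\<lambda>i r. if Suc r = d then 0 else Suc r) x = x mod d" for x
    by (induction x) (auto simp: mod_Suc Suc)
  ultimately show ?thesis by simp
qed

lemma computable_div [comp_intros]:
  assumes "computable f" shows "computable (\<lambda>A n. f A n div d)"
proof (cases d)
  case 0
  then show ?thesis by (simp add: computable_const)
next
  case (Suc d')
  have "computable (\<lambda>A n. rec_nat 0 (\<lambda>i r. if Suc i mod d = 0 then Suc r else r) (f A n))"
    by (intro comp_intros assms)
  moreover have "rec_nat 0 (\<lambda>i r. if Suc i mod d = 0 then Suc r else r) x = x div d" for x
    by (induction x) (auto simp: div_Suc Suc)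
  ultimately show ?thesis by simp
qed

lemma computable_funpow [comp_intros]:
  assumes "computable f" "computable k" "computable (\<lambda>A m. h A (pr1 m) (pr2 m))"
  shows "computable (\<lambda>A n. (h A n ^^ k A n) (f A n))"
proof -
  have "computable (\<lambda>A m. h A (pr1 m) (pr2 (pr2 m)))"
    by (rule computable_comp2[where h = h, OF assms(3)]) (intro comp_intros)+
  then have "computable (\<lambda>A n. rec_nat (f A n) (\<lambda>i r. h A n r) (k A n))"
    by (intro comp_intros assms)
  moreover have "rec_nat x (\<lambda>i r. h A n r) m = (h A n ^^ m) x" for A n m x by (induction m) auto
  ultimately show ?thesis by simp
qed

section \<open>Notations for the initial segments of computable linear orders\<close>

lemma two_power_ne: "0 < a \<Longrightarrow> (2 :: nat) ^ a \<noteq> 3 * 5 ^ e"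
proof
  assume "0 < a" "(2 :: nat) ^ a = 3 * 5 ^ e"
  then have "even (3 * 5 ^ e :: nat)" by (metis dvd_power dvd_refl)
  then show False by simp
qed

text \<open>The case \<open>a = 0\<close> has to be excluded: \<open>2 ^ 0\<close> is the notation
  \<open>1\<close>, while \<open>0\<close> is no notation.\<close>

lemma in_O_suc_iff: "0 < a \<Longrightarrow> in_O x (2 ^ a) \<longleftrightarrow> in_O x a"
proof
  assume "0 < a" "in_O x (2 ^ a)"
  from this(2) this(1) show "in_O x a"
    by (cases) (auto simp: two_power_ne)
qed (rule suc)

definition tower :: "nat \<Rightarrow> nat \<Rightarrow> nat" where
  "tower n a = ((\<lambda>b. 2 ^ b) ^^ n) a"

lemma tower_simps [simp]: "tower 0 a = a" "tower (Suc n) a = 2 ^ tower n a"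
  by (simp_all add: tower_def)

text \<open>
  An element \<open>t\<close> of the order is represented by \<open>Suc t\<close>, and \<open>0\<close> is an additional
  least element, so that every \<open>t\<close> has a predecessor to start its fundamental sequence with.
\<close>

primrec base_notation :: "(nat \<Rightarrow> nat) \<Rightarrow> nat \<Rightarrow> nat" where
  "base_notation e 0 = 1"
| "base_notation e (Suc t) = 3 * 5 ^ e t"

text \<open>A running maximum: the scan of the numbers below \<open>n\<close> keeps the greatest
  predecessor of \<open>t\<close> met so far, shifted by one, so that its values climb cofinally
  below \<open>t\<close>.\<close>

primrec greatest_below :: "(nat \<Rightarrow> nat \<Rightarrow> bool) \<Rightarrow> nat \<Rightarrow> nat \<Rightarrow> nat" where
  "greatest_below lt t 0 = 0"
| "greatest_below lt t (Suc n) =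
     (if lt n t \<and> (greatest_below lt t n = 0 \<or> lt (greatest_below lt t n - 1) n)
      then Suc n else greatest_below lt t n)"

text \<open>The running maximum may stand still; the \<open>n\<close> additional successors keep the
  sequence strictly increasing.\<close>

definition fundamental_seq :: "(nat \<Rightarrow> nat \<Rightarrow> bool) \<Rightarrow> (nat \<Rightarrow> nat) \<Rightarrow> nat \<Rightarrow> nat \<Rightarrow> nat" where
  "fundamental_seq lt e t n = tower n (base_notation e (greatest_below lt t n))"

lemma tower_base_pos: "0 < tower n (base_notation e c)"
  by (cases n; cases c) auto

lemma tower_base_ne_1: "tower n (base_notation e (Suc t)) \<noteq> 1"
proof (cases n)
  case (Suc m)
  then show ?thesis using tower_base_pos[of m e "Suc t"] by simp
qed simp

lemma in_O_tower_iff: "in_O x (tower n (base_notation e c)) \<longleftrightarrow> in_O x (base_notation e c)"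
  by (induction n) (auto simp: in_O_suc_iff tower_base_pos)

lemma less_O_tower:
  assumes "in_O x (base_notation e c)" "m < n"
  shows "less_O x (tower m (base_notation e c)) (tower n (base_notation e c))"
  using assms(2)
proof (induction n)
  case (Suc n)
  have "less_O x (tower n (base_notation e c)) (tower (Suc n) (base_notation e c))"
    using assms(1) by (auto intro!: less_suc simp: in_O_tower_iff)
  then show ?case using Suc by (cases "m = n") (auto intro: less_trans)
qed simp

text \<open>Comparability is required only of predecessors of a common element, since
  \<open>node_less\<close> demands a node only on its left. \<open>e t\<close> is the index of a
  sequence that itself mentions values of \<open>e\<close> at predecessors of
  \<open>t\<close>.\<close>

locale order_notation =
  fixes x :: "nat set" and lt :: "nat \<Rightarrow> nat \<Rightarrow> bool" and e :: "nat \<Rightarrow> nat"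
  assumes lt_trans: "lt a b \<Longrightarrow> lt b c \<Longrightarrow> lt a c"
    and lt_total: "lt a t \<Longrightarrow> lt b t \<Longrightarrow> a \<noteq> b \<Longrightarrow> lt a b \<or> lt b a"
    and index_run_e: "index_run x (e t) n = Some (fundamental_seq lt e t n)"
begin

lemma greatest_below_SucD: "greatest_below lt t n = Suc a \<Longrightarrow> lt a t"
  by (induction n) (auto split: if_splits)

lemma greatest_below_ge:
  assumes "lt a t" "a < n"
  shows "\<exists>b. greatest_below lt t n = Suc b \<and> (b = a \<or> lt a b)"
  using assms(2)
proof (induction n)
  case (Suc n)
  show ?case
  proof (cases "a = n")
    case True
    then show ?thesis
      using assms(1) lt_total[of n t "greatest_below lt t n - 1"] greatest_below_SucD[of t n]
      by (cases "greatest_below lt t n") auto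
  next
    case False
    then obtain b where "greatest_below lt t n = Suc b" "b = a \<or> lt a b"
      using Suc by auto
    then show ?thesis by (auto intro: lt_trans)
  qed
qed simp

text \<open>The induction needs all three parts at once: when the running maximum moves to a new
  element, every finite tower over the old one, or over the least element, must already lie below
  the notation of the new one.\<close>

lemma in_O_base_notation:
  assumes "Wellfounded.accp lt t"
  shows "in_O x (base_notation e (Suc t)) \<and>
    (\<forall>k. less_O x (tower k (base_notation e 0)) (base_notation e (Suc t))) \<and>
    (\<forall>a k. lt a t \<longrightarrow> less_O x (tower k (base_notation e (Suc a))) (base_notation e (Suc t)))"
  using assms
proof (induction t rule: Wellfounded.accp.induct)
  case (accI t)
  let ?B = "base_notation e" and ?g = "greatest_below lt t" and ?f = "fundamental_seq lt e t"
  have base: "in_O x (?B (?g n))" for n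
    using accI greatest_below_SucD[of t n] zero by (cases "?g n") auto
  have f_O: "in_O x (?f n)" for n
    unfolding fundamental_seq_def in_O_tower_iff by (rule base)
  have below: "less_O x (tower k (?B c)) (?B (?g n))"
    if "?g n = Suc b" "c = 0 \<or> (\<exists>a. c = Suc a \<and> lt a b)" for k c b n
    using that accI greatest_below_SucD[of t n b] by auto
  \<comment> \<open>If the maximum stays, the tower grows by one step; if it moves, the new maximum
    is \<open>n\<close>, and the old tower lies below its base notation by induction.\<close>
  have f_less: "less_O x (?f n) (?f (Suc n))" for n
  proof (cases "?g (Suc n) = ?g n")
    case True
    then show ?thesis unfolding fundamental_seq_def
      using less_O_tower[OF base lessI] by metis
  next
    case False
    then have "?g (Suc n) = Suc n" "?g n = 0 \<or> (\<exists>a. ?g n = Suc a \<and> lt a n)"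
      by (cases "?g n"; simp split: if_splits)+
    then have "less_O x (?f n) (?B (?g (Suc n)))" unfolding fundamental_seq_def
      by (rule below)
    also have "less_O x (?B (?g (Suc n))) (?f (Suc n))" unfolding fundamental_seq_def
      using less_O_tower[OF base[of "Suc n"], of 0 "Suc n"] by simp
    finally (less_trans) show ?thesis .
  qed
  have f_lim: "less_O x (?f n) (?B (Suc t))" for n
    using less_lim[of x "e t" ?f, OF index_run_e f_O f_less] by simp
  have "less_O x (tower k (?B 0)) (?B (Suc t))" for k
  proof (cases "?g (Suc k)")
    case 0
    then have "less_O x (tower k (?B 0)) (?f (Suc k))"
      unfolding fundamental_seq_def using less_O_tower[OF base[of "Suc k"], of k "Suc k"] by simp
    then show ?thesis by (rule less_trans[OF _ f_lim])
  next
    case (Suc b)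
    have "less_O x (tower k (?B 0)) (?B (?g (Suc k)))" by (rule below[OF Suc]) simp
    moreover have "less_O x (?B (?g (Suc k))) (?f (Suc k))" unfolding fundamental_seq_def
      using less_O_tower[OF base[of "Suc k"], of 0 "Suc k"] by simp
    ultimately show ?thesis by (rule less_trans[OF less_trans f_lim])
  qed
  moreover have "less_O x (tower k (?B (Suc a))) (?B (Suc t))" if a: "lt a t" for a k
  proof -
    \<comment> \<open>Past \<open>a\<close>, so that the maximum has reached \<open>a\<close>, and
      past \<open>k\<close>, so that the tower is higher than \<open>k\<close>.\<close>
    define n where "n = Suc (max a k)"
    have n: "a < n" "k < n" "0 < n" unfolding n_def by auto
    obtain b where b: "?g n = Suc b" "b = a \<or> lt a b"
      using greatest_below_ge[OF a n(1)] by blast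
    have "less_O x (tower k (?B (Suc a))) (?f n)"
    proof (cases "b = a")
      case True
      then show ?thesis unfolding fundamental_seq_def
        using less_O_tower[OF base[of n] n(2)] b by simp
    next
      case False
      have "less_O x (tower k (?B (Suc a))) (?B (?g n))"
        by (rule below[OF b(1)]) (use False b in simp)
      moreover have "less_O x (?B (?g n)) (?f n)" unfolding fundamental_seq_def
        using less_O_tower[OF base[of n] n(3)] by simp
      ultimately show ?thesis by (rule less_trans)
    qed
    then show ?thesis by (rule less_trans[OF _ f_lim])
  qed
  moreover have "in_O x (?B (Suc t))"
    using lim[of x "e t" ?f, OF index_run_e f_O f_less] by simp
  ultimately show ?case by blast
qed

text \<open>Induction on the derivation, stated for towers because the terms of a fundamental
  sequence are towers. The trivial predicate for \<open>less_O\<close> disposes of the mutual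
  half.\<close>

lemma accp_if_in_O:
  assumes "in_O x c" "c = tower k (base_notation e (Suc t))"
  shows "Wellfounded.accp lt t"
  using assms
proof (induction arbitrary: k t rule: in_O_less_O.inducts(1)[where ?P2.0 = "\<lambda>_ _. True"])
  case zero
  then show ?case using tower_base_ne_1[of k e t] by simp
next
  case (suc a)
  show ?case
  proof (cases k)
    case 0
    then have "(2 :: nat) ^ a = 3 * 5 ^ e t" using suc.prems by simp
    then show ?thesis using two_power_ne[of a "e t"] by (cases "a = 0") auto
  next
    case (Suc k')
    then have "a = tower k' (base_notation e (Suc t))" using suc.prems by simp
    then show ?thesis by (rule suc.IH)
  qed
next
  case (lim e' f)
  show ?case
  proof (cases k)
    case (Suc k')
    then show ?thesis
      using lim.prems two_power_ne[of "tower k' (base_notation e (Suc t))" e']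
        tower_base_pos[of k' e "Suc t"] by simp
  next
    case 0
    then have "e' = e t" using lim.prems by simp
    then have f: "f n = fundamental_seq lt e t n" for n
      using lim.hyps(1)[of n] index_run_e[of t n] by simp
    show ?thesis
    proof (rule Wellfounded.accp.accI)
      fix a assume "lt a t"
      \<comment> \<open>At stage \<open>Suc a\<close> the scan has seen \<open>a\<close>, so
        accessibility of the maximum \<open>b\<close> will pass down to \<open>a\<close>.\<close>
      then obtain b where b: "greatest_below lt t (Suc a) = Suc b" "b = a \<or> lt a b"
        using greatest_below_ge[of a t "Suc a"] by blast
      have "f (Suc a) = tower (Suc a) (base_notation e (Suc b))"
        unfolding f fundamental_seq_def b(1) ..
      then have "Wellfounded.accp lt b" by (rule lim.IH(1))
      then show "Wellfounded.accp lt a" using b(2) accp_downward by metis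
    qed
  qed
qed (rule TrueI)+

lemma in_O_iff_accp: "in_O x (3 * 5 ^ e t) \<longleftrightarrow> Wellfounded.accp lt t"
proof
  assume "in_O x (3 * 5 ^ e t)"
  then show "Wellfounded.accp lt t"
    by (rule accp_if_in_O[where k = 0]) (simp only: tower_simps base_notation.simps)
next
  assume "Wellfounded.accp lt t"
  from in_O_base_notation[OF this, THEN conjunct1] show "in_O x (3 * 5 ^ e t)"
    by (simp only: base_notation.simps)
qed

end

section \<open>Computable indices of fundamental sequences\<close>

text \<open>Mirrors \<open>const_prog\<close> on indices, so that passing from a number to the index
  of its constant program is visibly computable.\<close>

primrec const_index :: "nat \<Rightarrow> nat" where
  "const_index 0 = prog_index Zero"
| "const_index (Suc c) = 6 + 4 * prod_encode (prog_index Succ, const_index c)"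

definition const_prog :: "nat \<Rightarrow> prog" where
  "const_prog c = (Comp Succ ^^ c) Zero"

lemma prog_index_const_prog: "prog_index (const_prog c) = const_index c"
  by (induction c) (simp_all add: const_prog_def)

lemma run_const_prog: "run A (const_prog c) n = Some c"
  by (induction c) (simp_all add: const_prog_def)

text \<open>The parametrisation function: the index of the program that feeds \<open>y\<close>,
  paired with the input, to program \<open>z\<close>. \<open>Pairing Proj1 Proj2\<close> is the
  identity.\<close>

definition smn :: "nat \<Rightarrow> nat \<Rightarrow> nat" where
  "smn z y = 6 + 4 * prod_encode (z, 5 + 4 * prod_encode (const_index y, prog_index (Pairing Proj1 Proj2)))"

lemma index_run_prog_index: "index_run A (prog_index p) n = run A p n"
  by (simp add: index_run_def inv_f_f[OF bij_is_inj[OF bij_prog_index]])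

lemma index_run_smn: "index_run A (smn (prog_index p) y) n = run A p (prod_encode (y, n))"
proof -
  have "smn (prog_index p) y = prog_index (Comp p (Pairing (const_prog y) (Pairing Proj1 Proj2)))"
    by (simp add: smn_def prog_index_const_prog)
  then show ?thesis by (simp only: index_run_prog_index) (simp add: run_const_prog)
qed

lemma computable_smn [comp_intros]:
  assumes "computable f" "computable g" shows "computable (\<lambda>A n. smn (f A n) (g A n))"
proof -
  have "const_index = rec_nat (prog_index Zero) (\<lambda>i r. 6 + 4 * prod_encode (prog_index Succ, r))"
    unfolding const_index_def ..
  moreover have "computable (\<lambda>A n. rec_nat (prog_index Zero)
      (\<lambda>i r. 6 + 4 * prod_encode (prog_index Succ, r)) (g A n))"
    by (intro comp_intros assms)
  ultimately have [comp_intros]: "computable (\<lambda>A n. const_index (g A n))" by simp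
  show ?thesis unfolding smn_def by (intro comp_intros assms)
qed

lemma computable_greatest_below [comp_intros]:
  assumes "decidable (\<lambda>A m. lt A (pr1 m) (pr1 (pr2 m)) (pr2 (pr2 m)))"
    and "computable p" "computable t" "computable n"
  shows "computable (\<lambda>A m. greatest_below (lt A (p A m)) (t A m) (n A m))"
proof -
  have *: "greatest_below l s k = rec_nat 0 (\<lambda>i r. if l i s \<and> (r = 0 \<or> l (r - 1) i) then Suc i else r) k"
    for l s k
    by (induction k) auto
  show ?thesis
    unfolding * by (intro comp_intros assms decidable_comp3[where P = lt, OF assms(1)]
        computable_comp[OF _ assms(2)] computable_comp[OF _ assms(3)])
qed

text \<open>
  The indices \<open>e A p t\<close> of the fundamental sequences refer to each other.  As the sequences only
  mention these indices and never run them, the parametrisation theorem is enough to solve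
  this recursion: the parameter contains the index of the program itself.
\<close>

lemma ex_notation:
  assumes dec: "decidable (\<lambda>A m. lt A (pr1 m) (pr1 (pr2 m)) (pr2 (pr2 m)))"
  shows "\<exists>e. computable (\<lambda>A m. e (pr1 m) (pr2 m)) \<and>
     (\<forall>A p t n. index_run A (e p t) n = Some (fundamental_seq (lt A p) (e p) t n))"
proof -
  define e where "e z p t = smn z (prod_encode (z, prod_encode (p, t)))" for z p t
  define G where "G A m = (let z = pr1 (pr1 m); p = pr1 (pr2 (pr1 m)); t = pr2 (pr2 (pr1 m))
     in fundamental_seq (lt A p) (e z p) t (pr2 m))" for A m
  have base: "base_notation d c = (if c = 0 then 1 else 3 * 5 ^ d (c - 1))" for d c
    by (cases c) auto
  have "computable G"
    unfolding G_def Let_def fundamental_seq_def tower_def base e_def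
    by (intro comp_intros dec)
  then obtain q where q: "\<And>A m. run A q m = Some (G A m)" unfolding computable_def by blast
  have "index_run A (e (prog_index q) p t) n
      = Some (fundamental_seq (lt A p) (e (prog_index q) p) t n)" for A p t n
    unfolding e_def index_run_smn q by (simp add: G_def e_def[abs_def] Let_def)
  moreover have "computable (\<lambda>A m. e (prog_index q) (pr1 m) (pr2 m))"
    unfolding e_def by (intro comp_intros)
  ultimately show ?thesis by blast
qed

section \<open>Reduction of countable systems of equivalences to Kleene's O\<close>

text \<open>A single infinitary connective: \<open>q\<close> is the NAND of the sentences listed by
  \<open>s q\<close>, with \<open>0\<close> as an empty slot.\<close>

definition model :: "(nat \<Rightarrow> nat \<Rightarrow> nat) \<Rightarrow> (nat \<Rightarrow> bool) \<Rightarrow> bool" where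
  "model s v \<longleftrightarrow> (\<forall>q. v q \<longleftrightarrow> (\<exists>k r. s q k = Suc r \<and> \<not> v r))"

section \<open>The Kleene-Brouwer order on codes of finite sequences\<close>

definition entry :: "nat \<Rightarrow> nat \<Rightarrow> nat" where
  "entry c i = (if ((\<lambda>d. pr2 (d - 1)) ^^ i) c = 0 then 0
     else Suc (pr1 (((\<lambda>d. pr2 (d - 1)) ^^ i) c - 1)))"

text \<open>\<open>list_encode\<close> makes a nonempty list the successor of the pair of head and
  tail; iterating \<open>pr2 (d - 1)\<close> drops entries and rests at \<open>0\<close> after the
  end.\<close>

lemma entry_list_encode:
  "entry (list_encode xs) i = (if i < length xs then Suc (xs ! i) else 0)"
proof (induction xs arbitrary: i)
  case Nil
  have "((\<lambda>d. pr2 (d - 1)) ^^ i) 0 = 0"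
    by (induction i) (auto simp: prod_decode_def prod_decode_aux.simps)
  then show ?case by (simp add: entry_def)
next
  case (Cons x xs)
  show ?case
  proof (cases i)
    case (Suc j)
    then have "entry (list_encode (x # xs)) i = entry (list_encode xs) j"
      by (simp add: entry_def funpow_Suc_right del: funpow.simps)
    then show ?thesis using Cons.IH[of j] Suc by simp
  qed (simp add: entry_def)
qed

lemma length_le_list_encode: "length xs \<le> list_encode xs"
  by (induction xs) (auto intro: order_trans le_prod_encode_2)

lemma ex_list_encode: "\<exists>xs. c = list_encode xs"
  by (metis list_decode_inverse)

text \<open>Justifies the bound \<open>i < c\<close> in \<open>kb_less\<close>, which keeps that
  relation decidable.\<close>

lemma entry_bound: "entry c i \<noteq> 0 \<Longrightarrow> i < c"
  using ex_list_encode[of c] length_le_list_encode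
  by (auto simp: entry_list_encode split: if_splits intro: less_le_trans)

lemma entry_zero_mono: "entry c i = 0 \<Longrightarrow> i \<le> j \<Longrightarrow> entry c j = 0"
  using ex_list_encode[of c] by (auto simp: entry_list_encode split: if_splits)

lemma entry_inject:
  assumes "\<And>i. entry c i = entry d i" shows "c = d"
proof -
  obtain xs ys where cd: "c = list_encode xs" "d = list_encode ys"
    using ex_list_encode by metis
  have i: "(if i < length xs then Suc (xs ! i) else 0) = (if i < length ys then Suc (ys ! i) else 0)" for i
    using assms[of i] unfolding cd entry_list_encode .
  have "length xs = length ys"
    using i[of "length xs"] i[of "length ys"] by (auto split: if_splits)
  moreover have "xs ! j = ys ! j" if "j < length xs" for j
    using i[of j] that calculation by simp
  ultimately have "xs = ys" by (rule nth_equalityI)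
  then show ?thesis unfolding cd by simp
qed

text \<open>
  As \<open>entry d i = 0\<close> means that \<open>d\<close> ends before \<open>i\<close>, proper extensions are smaller.
\<close>

definition kb_less :: "nat \<Rightarrow> nat \<Rightarrow> bool" where
  "kb_less c d \<longleftrightarrow> (\<exists>i<c. (\<forall>j<i. entry c j = entry d j) \<and> entry c i \<noteq> 0 \<and>
     (entry d i = 0 \<or> entry c i < entry d i))"

lemma kb_lessI:
  "(\<And>j. j < i \<Longrightarrow> entry c j = entry d j) \<Longrightarrow> entry c i \<noteq> 0 \<Longrightarrow>
    entry d i = 0 \<or> entry c i < entry d i \<Longrightarrow> kb_less c d"
  unfolding kb_less_def using entry_bound by blast

lemma kb_less_trans:
  assumes "kb_less a b" "kb_less b c" shows "kb_less a c"
proof -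
  obtain i where i: "\<forall>j<i. entry a j = entry b j" "entry a i \<noteq> 0"
    "entry b i = 0 \<or> entry a i < entry b i" using assms(1) unfolding kb_less_def by blast
  obtain j where j: "\<forall>k<j. entry b k = entry c k" "entry b j \<noteq> 0"
    "entry c j = 0 \<or> entry b j < entry c j" using assms(2) unfolding kb_less_def by blast
  show ?thesis
  \<comment> \<open>The earlier of the two places of difference decides the comparison.\<close>
  proof (rule kb_lessI[of "min i j"])
    show "entry a k = entry c k" if "k < min i j" for k using i(1) j(1) that by simp
    show "entry a (min i j) \<noteq> 0" using i j by (cases "i \<le> j") (auto simp: min_def)
    show "entry c (min i j) = 0 \<or> entry a (min i j) < entry c (min i j)"
      using i j by (cases i j rule: linorder_cases) (auto simp: min_def)
  qed
qed

lemma kb_less_total: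
  assumes "c \<noteq> d" shows "kb_less c d \<or> kb_less d c"
proof -
  define i where "i = (LEAST i. entry c i \<noteq> entry d i)"
  have "\<exists>i. entry c i \<noteq> entry d i" using entry_inject assms by blast
  then have i: "entry c i \<noteq> entry d i" unfolding i_def by (rule LeastI_ex)
  have j: "entry c j = entry d j" if "j < i" for j
    using not_less_Least that unfolding i_def by blast
  show ?thesis
  proof (cases "entry c i \<noteq> 0 \<and> (entry d i = 0 \<or> entry c i < entry d i)")
    case True
    then show ?thesis using kb_lessI[of i c d] j by blast
  next
    case False
    then have "entry d i \<noteq> 0 \<and> (entry c i = 0 \<or> entry d i < entry c i)" using i by auto
    then show ?thesis using kb_lessI[of i d c] j by simp
  qed
qed

text \<open>
  Nodes are finite approximations of a model of \<open>s\<close> satisfying \<open>p\<close>, together with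
  witnesses: the value \<open>0\<close> at \<open>q\<close> means that \<open>q\<close> is false, and the value \<open>Suc k\<close> means
  that \<open>q\<close> is true because of \<open>s q k\<close>.  Note that \<^const>\<open>entry\<close> adds another \<^const>\<open>Suc\<close>.
\<close>

definition node :: "(nat \<Rightarrow> nat \<Rightarrow> nat) \<Rightarrow> nat \<Rightarrow> nat \<Rightarrow> bool" where
  "node s p c \<longleftrightarrow> entry c p \<noteq> 1 \<and> (\<forall>q<c. \<forall>k<c.
     (entry c q = 1 \<and> s q k \<noteq> 0 \<longrightarrow> entry c (s q k - 1) \<noteq> 1) \<and>
     (2 \<le> entry c q \<longrightarrow> s q (entry c q - 2) \<noteq> 0 \<and> entry c (s q (entry c q - 2) - 1) \<le> 1))"

text \<open>The root \<open>0\<close> codes the empty sequence, which lies above every other;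
  well-foundedness of the order on the nodes is therefore accessibility of \<open>0\<close>.\<close>

definition node_less :: "(nat \<Rightarrow> nat \<Rightarrow> nat) \<Rightarrow> nat \<Rightarrow> nat \<Rightarrow> nat \<Rightarrow> bool" where
  "node_less s p c d \<longleftrightarrow> node s p c \<and> kb_less c d"

text \<open>The initial segments of a model with chosen witnesses are nodes that descend forever
  from the root.\<close>

lemma not_accp_if_model:
  assumes "model s v" "v p" shows "\<not> Wellfounded.accp (node_less s p) 0"
proof -
  define f where "f q = (if v q then Suc (SOME k. \<exists>r. s q k = Suc r \<and> \<not> v r) else 0)" for q
  have f: "\<exists>r. s q (f q - 1) = Suc r \<and> \<not> v r" if "v q" for q
  proof -
    have "\<exists>k r. s q k = Suc r \<and> \<not> v r" using assms(1) that unfolding model_def by blast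
    from someI_ex[OF this] show ?thesis using that by (simp add: f_def)
  qed
  have f0: "f q = 0 \<longleftrightarrow> \<not> v q" for q by (simp add: f_def)
  define c where "c n = list_encode (map f [0..<n])" for n
  have c: "entry (c n) i = (if i < n then Suc (f i) else 0)" for n i
    by (simp add: c_def entry_list_encode)
  have "node s p (c n)" for n
    unfolding node_def
  proof (intro conjI allI impI)
    show "entry (c n) p \<noteq> 1" using assms(2) by (simp add: c f0)
  next
    fix q k assume "entry (c n) q = 1 \<and> s q k \<noteq> 0"
    then have q: "\<not> v q" "s q k \<noteq> 0" by (auto simp: c f0 split: if_splits)
    then obtain r where r: "s q k = Suc r" by (cases "s q k") auto
    then have "v r" using q assms(1) unfolding model_def by blast
    then show "entry (c n) (s q k - 1) \<noteq> 1" by (simp add: c f0 r)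
  next
    fix q assume "2 \<le> entry (c n) q"
    then have q: "f q \<noteq> 0" "q < n" by (auto simp: c split: if_splits)
    then obtain r where r: "s q (f q - 1) = Suc r" "\<not> v r" using f[of q] f0[of q] by auto
    have *: "entry (c n) q - 2 = f q - 1" using q by (simp add: c)
    show "s q (entry (c n) q - 2) \<noteq> 0" unfolding * r by simp
    show "entry (c n) (s q (entry (c n) q - 2) - 1) \<le> 1"
      unfolding * r using r(2) f0[of r] by (simp add: c)
  qed
  moreover have "kb_less (c (Suc n)) (c n)" for n
    by (rule kb_lessI[of n]) (auto simp: c)
  ultimately have less: "node_less s p (c (Suc n)) (c n)" for n by (simp add: node_less_def)
  have "x \<noteq> c n" if "Wellfounded.accp (node_less s p) x" for x n
    using that by (induction arbitrary: n rule: Wellfounded.accp.induct) (metis less)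
  moreover have "c 0 = 0" by (simp add: c_def)
  ultimately show ?thesis by metis
qed

text \<open>
  If the Kleene-Brouwer order is not well-founded, then the leftmost path through the
  sequences with an extension outside the well-founded part is infinite.
\<close>

lemma ex_model_if_not_accp:
  assumes "\<not> Wellfounded.accp (node_less s p) 0"
  shows "\<exists>v. model s v \<and> v p"
proof -
  let ?acc = "Wellfounded.accp (node_less s p)"
  define pre where "pre xs c \<longleftrightarrow> (\<forall>i<length xs. entry c i = Suc (xs ! i))" for xs :: "nat list" and c
  define ext where "ext xs \<longleftrightarrow> (\<exists>c. node s p c \<and> \<not> ?acc c \<and> pre xs c)" for xs
  define left where "left xs \<longleftrightarrow> (\<forall>c i. node s p c \<and> i < length xs \<and>
     (\<forall>j<i. entry c j = Suc (xs ! j)) \<and> entry c i \<noteq> 0 \<and> entry c i < Suc (xs ! i) \<longrightarrow> ?acc c)"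
    for xs :: "nat list"
  have pre_snoc: "pre (xs @ [k]) c \<longleftrightarrow> pre xs c \<and> entry c (length xs) = Suc k" for xs k c
    unfolding pre_def by (auto simp: nth_append less_Suc_eq)
  have step: "\<exists>k. ext (xs @ [k]) \<and> left (xs @ [k])" if xs: "ext xs" "left xs" for xs
  proof -
    have acc: "?acc c" if "node s p c" "pre xs c" "entry c (length xs) = Suc k" "\<not> ext (xs @ [k])" for c k
      using that unfolding ext_def pre_snoc by blast
    have "\<exists>k. ext (xs @ [k])"
    proof (rule ccontr)
      assume no: "\<nexists>k. ext (xs @ [k])"
      obtain c where c: "node s p c" "\<not> ?acc c" "pre xs c" using xs(1) unfolding ext_def by blast
      have c0: "entry c (length xs) = 0" using acc[OF c(1,3)] c(2) no by (cases "entry c (length xs)") auto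
      \<comment> \<open>A node below \<open>c\<close> either leaves \<open>xs\<close> to the left
        before its end, or passes through all of \<open>xs\<close> and is accessible because no
        one-entry extension satisfies \<open>ext\<close>. It cannot first differ later, as
        \<open>c\<close> ends where \<open>xs\<close> does.\<close>
      have "?acc c"
      proof (rule Wellfounded.accp.accI)
        fix d assume "node_less s p d c"
        then obtain i where d: "node s p d" "\<forall>j<i. entry d j = entry c j" "entry d i \<noteq> 0"
          "entry c i = 0 \<or> entry d i < entry c i"
          unfolding node_less_def kb_less_def by blast
        show "?acc d"
        proof (cases i "length xs" rule: linorder_cases)
          case less
          then show ?thesis using xs(2)[unfolded left_def] d c(3) unfolding pre_def by auto
        next
          case equal
          then have "pre xs d" using d(2) c(3) unfolding pre_def by simp
          then show ?thesis using acc[OF d(1)] no d(3) equal by (cases "entry d i") auto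
        next
          case greater
          then show ?thesis using d(2,3) c0 entry_zero_mono[of d "length xs" i] by simp
        qed
      qed
      then show False using c(2) by simp
    qed
    then have ext: "ext (xs @ [LEAST k. ext (xs @ [k])])" by (rule LeastI_ex)
    moreover have "left (xs @ [LEAST k. ext (xs @ [k])])"
      unfolding left_def
    proof (intro allI impI, elim conjE)
      fix c i
      assume c: "node s p c" "i < length (xs @ [LEAST k. ext (xs @ [k])])"
        "\<forall>j<i. entry c j = Suc ((xs @ [LEAST k. ext (xs @ [k])]) ! j)" "entry c i \<noteq> 0"
        "entry c i < Suc ((xs @ [LEAST k. ext (xs @ [k])]) ! i)"
      show "?acc c"
      proof (cases "i < length xs")
        case True
        then show ?thesis using xs(2)[unfolded left_def] c by (auto simp: nth_append)
      next
        case False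
        then have i: "i = length xs" using c(2) by simp
        then obtain k where k: "entry c (length xs) = Suc k" using c(4) by (cases "entry c i") auto
        then have "k < (LEAST k. ext (xs @ [k]))" using c(5) i by simp
        then have "\<not> ext (xs @ [k])" by (rule not_less_Least)
        moreover have "pre xs c" using c(3) i unfolding pre_def by (simp add: nth_append)
        ultimately show ?thesis using acc c(1) k by blast
      qed
    qed
    ultimately show ?thesis by blast
  qed
  have start: "ext []"
  proof -
    have "\<exists>c. node_less s p c 0 \<and> \<not> ?acc c" using assms Wellfounded.accp.accI by metis
    then show ?thesis unfolding ext_def pre_def node_less_def by auto
  qed
  have "\<exists>g. \<forall>n. (ext (g n) \<and> left (g n) \<and> length (g n) = n) \<and> (\<exists>k. g (Suc n) = g n @ [k])"
  proof (rule dependent_nat_choice)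
    show "\<exists>xs. ext xs \<and> left xs \<and> length xs = 0" using start unfolding left_def by auto
    show "\<exists>ys. (ext ys \<and> left ys \<and> length ys = Suc n) \<and> (\<exists>k. ys = xs @ [k])"
      if "ext xs \<and> left xs \<and> length xs = n" for xs n
      using step[of xs] that by (metis length_append_singleton)
  qed
  then obtain g where g: "\<And>n. ext (g n)" "\<And>n. length (g n) = n" "\<And>n. \<exists>k. g (Suc n) = g n @ [k]"
    by metis
  define f where "f i = g (Suc i) ! i" for i
  have gf: "g n ! i = f i" if "i < n" for n i
    using that
  proof (induction n)
    case (Suc n)
    then show ?case using g(2)[of n] g(3)[of n] by (cases "i = n") (auto simp: f_def nth_append)
  qed simp
  have path: "\<exists>c. node s p c \<and> (\<forall>i<n. entry c i = Suc (f i)) \<and> n \<le> c" for n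
  proof -
    obtain c where c: "node s p c" "\<forall>i<n. entry c i = Suc (f i)"
      using g(1)[of n] g(2)[of n] gf unfolding ext_def pre_def by metis
    have "n \<le> c"
    proof (cases n)
      case (Suc m)
      then show ?thesis using c(2) entry_bound[of c m] by simp
    qed simp
    then show ?thesis using c by blast
  qed
  have "model s (\<lambda>q. f q \<noteq> 0)"
    unfolding model_def
  proof (intro allI iffI)
    fix q assume "f q \<noteq> 0"
    then obtain k where k: "f q = Suc k" by (cases "f q") auto
    \<comment> \<open>The prefix covers both \<open>q\<close> and the sentence
      \<open>s q k - 1\<close>, and the code exceeds \<open>q\<close>, so the bounded conditions of
      \<open>node\<close> apply.\<close>
    obtain c where c: "node s p c" "\<forall>i<Suc (q + s q k). entry c i = Suc (f i)" "Suc (q + s q k) \<le> c"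
      using path by blast
    have q: "entry c q = Suc (Suc k)" using c(2) k by simp
    have "q < c" "0 < c" using c(3) by auto
    then have "2 \<le> entry c q \<longrightarrow> s q (entry c q - 2) \<noteq> 0 \<and> entry c (s q (entry c q - 2) - 1) \<le> 1"
      using c(1) unfolding node_def by blast
    then have s: "s q k \<noteq> 0" "entry c (s q k - 1) \<le> 1" by (simp_all add: q)
    then obtain r where r: "s q k = Suc r" by (cases "s q k") auto
    then have "f r = 0" using s(2) c(2) by simp
    then show "\<exists>k r. s q k = Suc r \<and> \<not> f r \<noteq> 0" using r by blast
  next
    fix q assume "\<exists>k r. s q k = Suc r \<and> \<not> f r \<noteq> 0"
    then obtain k r where kr: "s q k = Suc r" "f r = 0" by blast
    \<comment> \<open>Here the code must also exceed \<open>k\<close>, since \<open>node\<close>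
      tests the clauses of a false sentence only for \<open>k\<close> below the code.\<close>
    obtain c where c: "node s p c" "\<forall>i<Suc (q + k + r). entry c i = Suc (f i)" "Suc (q + k + r) \<le> c"
      using path by blast
    have "q < c" "k < c" using c(3) by auto
    then have "\<not> (entry c q = 1 \<and> s q k \<noteq> 0 \<and> entry c (s q k - 1) = 1)"
      using c(1) unfolding node_def by blast
    then show "f q \<noteq> 0" using c(2) kr by simp
  qed
  moreover have "f p \<noteq> 0"
  proof -
    obtain c where c: "node s p c" "\<forall>i<Suc p. entry c i = Suc (f i)" using path by blast
    have "entry c p \<noteq> 1" using c(1) unfolding node_def by (rule conjunct1)
    then show ?thesis using c(2) by simp
  qed
  ultimately show ?thesis by blast
qed

lemma computable_entry [comp_intros]:
  assumes "computable c" "computable i" shows "computable (\<lambda>A n. entry (c A n) (i A n))"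
  unfolding entry_def by (intro comp_intros assms)

text \<open>\<open>h p\<close> is the notation for the part of the order below the root of the tree
  for \<open>p\<close>. It depends on \<open>p\<close> alone, since the programs behind the indices
  \<open>e\<close> consult the oracle only when run.\<close>

lemma ex_reduction_to_Kleene_O:
  assumes s: "computable (\<lambda>A m. s A (pr1 m) (pr2 m))"
  shows "\<exists>h. computable (\<lambda>A. h) \<and>
    (\<forall>A p. h p \<in> Kleene_O A \<longleftrightarrow> \<not> (\<exists>v. model (s A) v \<and> v p))"
proof -
  have "decidable (\<lambda>A m. node_less (s A) (pr1 m) (pr1 (pr2 m)) (pr2 (pr2 m)))"
    unfolding node_less_def node_def kb_less_def
    by (intro comp_intros computable_comp2[where h = s, OF s])
  from ex_notation[where lt = "\<lambda>A. node_less (s A)", OF this]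
  obtain e where e: "computable (\<lambda>A m. e (pr1 m) (pr2 m))"
    and run: "\<And>A p t n. index_run A (e p t) n = Some (fundamental_seq (node_less (s A) p) (e p) t n)"
    by blast
  define h :: "nat \<Rightarrow> nat" where "h p = 3 * 5 ^ e p 0" for p
  have "h p \<in> Kleene_O A \<longleftrightarrow> \<not> (\<exists>v. model (s A) v \<and> v p)" for A p
  proof -
    interpret order_notation A "node_less (s A) p" "e p"
    proof
      show "node_less (s A) p a c" if "node_less (s A) p a b" "node_less (s A) p b c" for a b c
        using that kb_less_trans unfolding node_less_def by blast
      show "node_less (s A) p a b \<or> node_less (s A) p b a"
        if "node_less (s A) p a t" "node_less (s A) p b t" "a \<noteq> b" for a b t
        using that kb_less_total unfolding node_less_def by blast
    qed (rule run)
    have "h p \<in> Kleene_O A \<longleftrightarrow> Wellfounded.accp (node_less (s A) p) 0"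
      unfolding h_def Kleene_O_def mem_Collect_eq by (rule in_O_iff_accp)
    then show ?thesis
      using not_accp_if_model[of "s A" _ p] ex_model_if_not_accp[of "s A" p] by blast
  qed
  moreover have "computable (\<lambda>A. h)"
    unfolding h_def by (intro comp_intros computable_comp2[where h = "\<lambda>A. e", OF e])
  ultimately show ?thesis by blast
qed

section \<open>Ordinals and the constructible hierarchy\<close>

lemma wf_elts: "wf {(x, y). x \<in> elts y}"
proof (rule wfUNIVI)
  fix P :: "hc \<Rightarrow> bool" and x
  assume IH: "\<forall>x. (\<forall>y. (y, x) \<in> {(x, y). x \<in> elts y} \<longrightarrow> P y) \<longrightarrow> P x"
  show "P x"
  proof (induction x)
    case (HC A)
    show ?case using IH HC by (simp add: elts_def)
  qed
qed

lemmas elts_induct = wf_induct_rule[OF wf_elts, simplified, case_names less]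

lemma not_elts_self: "x \<notin> elts x"
  using wf_not_refl[OF wf_elts] by simp

lemma is_ordinal_elts: "is_ordinal \<beta> \<Longrightarrow> \<gamma> \<in> elts \<beta> \<Longrightarrow> is_ordinal \<gamma>"
  unfolding is_ordinal_def transitive_set_def by blast

lemma is_ordinal_trans: "is_ordinal \<beta> \<Longrightarrow> \<gamma> \<in> elts \<beta> \<Longrightarrow> \<delta> \<in> elts \<gamma> \<Longrightarrow> \<delta> \<in> elts \<beta>"
  unfolding is_ordinal_def transitive_set_def by blast

text \<open>Double induction on membership: if neither ordinal belongs to the other, each is
  included in the other, so they are equal.\<close>

lemma is_ordinal_linear:
  "is_ordinal \<beta> \<Longrightarrow> is_ordinal \<gamma> \<Longrightarrow> \<beta> \<in> elts \<gamma> \<or> \<beta> = \<gamma> \<or> \<gamma> \<in> elts \<beta>"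
proof (induction \<beta> arbitrary: \<gamma> rule: elts_induct)
  case (less \<beta>)
  note outer = less.IH and \<beta> = less.prems(1)
  from less.prems(2) show ?case
  proof (induction \<gamma> rule: elts_induct)
    case (less \<gamma>)
    show ?case
    proof (rule ccontr)
      assume no: "\<not> (\<beta> \<in> elts \<gamma> \<or> \<beta> = \<gamma> \<or> \<gamma> \<in> elts \<beta>)"
      have "z \<in> elts \<gamma>" if z: "z \<in> elts \<beta>" for z
        using outer[OF z is_ordinal_elts[OF \<beta> z] less.prems] no z is_ordinal_trans[OF \<beta> z] by blast
      moreover have "z \<in> elts \<beta>" if z: "z \<in> elts \<gamma>" for z
        using less.IH[OF z is_ordinal_elts[OF less.prems z]] no z is_ordinal_trans[OF less.prems z]
        by blast
      ultimately have "\<beta> = \<gamma>" using elts_inject by blast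
      then show False using no by blast
    qed
  qed
qed

lemma DefI:
  assumes "X_free \<phi>" "\<And>i. i \<in> free_vars \<phi> \<Longrightarrow> i \<noteq> 0 \<Longrightarrow> e i \<in> M"
    "elts x = {a \<in> M. sat M {} (e(0 := a)) \<phi>}"
  shows "x \<in> Def M"
  using assms unfolding Def_def by blast

lemma Def_elts_subset: "x \<in> Def M \<Longrightarrow> elts x \<subseteq> M"
  unfolding Def_def by blast

lemma L_mono: "elts \<beta> \<subseteq> elts \<alpha> \<Longrightarrow> L \<beta> \<subseteq> L \<alpha>"
  unfolding L_unfold[of \<alpha>] L_unfold[of \<beta>] by blast

lemma L_transitive:
  assumes "is_ordinal \<alpha>" "x \<in> L \<alpha>" shows "elts x \<subseteq> L \<alpha>"
proof -
  obtain \<beta> where \<beta>: "\<beta> \<in> elts \<alpha>" "x \<in> Def (L \<beta>)" using assms(2) unfolding L_unfold[of \<alpha>] by blast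
  have "L \<beta> \<subseteq> L \<alpha>" by (rule L_mono) (use is_ordinal_trans[OF assms(1) \<beta>(1)] in blast)
  then show ?thesis using Def_elts_subset[OF \<beta>(2)] by blast
qed

text \<open>Transitivity of \<open>v0\<close> and of all its elements. All quantifiers are bounded,
  hence the formula is absolute for transitive \<open>M\<close>.\<close>

definition ordinal_fml :: fml where
  "ordinal_fml = Neg (Exists 1 (Conj (Mem 1 0) (Exists 2 (Conj (Mem 2 1)
     (Neg (Conj (Mem 2 0) (Neg (Exists 3 (Conj (Mem 3 2) (Neg (Mem 3 1)))))))))))"

lemma ordinal_fml: "X_free ordinal_fml" "free_vars ordinal_fml = {0}"
  by (auto simp: ordinal_fml_def)

lemma sat_ordinal_fml:
  assumes "\<And>x. x \<in> M \<Longrightarrow> elts x \<subseteq> M" "e 0 \<in> M"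
  shows "sat M X e ordinal_fml \<longleftrightarrow> is_ordinal (e 0)"
proof -
  have "sat M X e ordinal_fml \<longleftrightarrow> (\<forall>y\<in>M. y \<in> elts (e 0) \<longrightarrow> (\<forall>z\<in>M. z \<in> elts y \<longrightarrow>
      z \<in> elts (e 0) \<and> (\<forall>w\<in>M. w \<in> elts z \<longrightarrow> w \<in> elts y)))"
    unfolding ordinal_fml_def by simp
  also have "\<dots> \<longleftrightarrow> (\<forall>y\<in>elts (e 0). \<forall>z\<in>elts y. z \<in> elts (e 0) \<and> (\<forall>w\<in>elts z. w \<in> elts y))"
    using assms by blast
  also have "\<dots> \<longleftrightarrow> is_ordinal (e 0)"
    unfolding is_ordinal_def transitive_set_def by blast
  finally show ?thesis .
qed

text \<open>Each \<gamma> in \<beta> is definable over \<open>L \<gamma>\<close> as the set of its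
  ordinals. Conversely, an ordinal definable over \<open>L \<gamma>\<close> is included in \<gamma>,
  so it cannot exceed \<gamma>.\<close>

lemma ordinals_in_L: "is_ordinal \<beta> \<Longrightarrow> {z \<in> L \<beta>. is_ordinal z} = elts \<beta>"
proof (induction \<beta> rule: elts_induct)
  case (less \<beta>)
  show ?case
  proof (intro equalityI subsetI)
    fix \<gamma> assume \<gamma>: "\<gamma> \<in> elts \<beta>"
    note o = is_ordinal_elts[OF less.prems \<gamma>]
    have "elts \<gamma> = {a \<in> L \<gamma>. sat (L \<gamma>) {} ((\<lambda>_. \<gamma>)(0 := a)) ordinal_fml}"
      unfolding less.IH[OF \<gamma> o, symmetric] using sat_ordinal_fml[OF L_transitive[OF o]] by auto
    then have "\<gamma> \<in> Def (L \<gamma>)"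
      by (rule DefI[rotated 2]) (simp_all add: ordinal_fml)
    then show "\<gamma> \<in> {z \<in> L \<beta>. is_ordinal z}" using o \<gamma> unfolding L_unfold[of \<beta>] by blast
  next
    fix z assume "z \<in> {z \<in> L \<beta>. is_ordinal z}"
    then obtain \<gamma> where \<gamma>: "\<gamma> \<in> elts \<beta>" "z \<in> Def (L \<gamma>)" and z: "is_ordinal z"
      unfolding L_unfold[of \<beta>] by blast
    note o = is_ordinal_elts[OF less.prems \<gamma>(1)]
    have "elts z \<subseteq> elts \<gamma>"
      unfolding less.IH[OF \<gamma>(1) o, symmetric]
      using Def_elts_subset[OF \<gamma>(2)] is_ordinal_elts[OF z] by blast
    then have "\<gamma> \<notin> elts z" using not_elts_self by blast
    then show "z \<in> elts \<beta>"
      using is_ordinal_linear[OF z o] \<gamma>(1) is_ordinal_trans[OF less.prems \<gamma>(1)] by blast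
  qed
qed

section \<open>Names for the elements of the constructible hierarchy\<close>

lemma pr_le: "pr1 n \<le> n" "pr2 n \<le> n"
  using le_prod_encode_1[of "pr1 n" "pr2 n"] le_prod_encode_2[of "pr2 n" "pr1 n"] by simp_all

lemma div_less_self: "0 < n mod d \<Longrightarrow> 1 < d \<Longrightarrow> n div d < (n :: nat)"
  by (cases "n = 0") auto

lemma pr_div_less:
  assumes "0 < n mod d" "1 < d"
  shows "pr1 (n div d) < n" "pr2 (n div d) < n" "pr2 (pr2 (n div d)) < n"
  using div_less_self[OF assms] pr_le(1)[of "n div d"] pr_le(2)[of "n div d"]
    pr_le(2)[of "pr2 (n div d)"] by linarith+

section \<open>Numerical codes of formulas and assignments\<close>

definition tagged :: "nat \<Rightarrow> nat \<Rightarrow> nat \<Rightarrow> nat" where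
  "tagged d t c = d * c + t"

lemma tagged_div_mod [simp]:
  "t < d \<Longrightarrow> tagged d t c div d = c" "t < d \<Longrightarrow> tagged d t c mod d = t"
  by (simp_all add: tagged_def)

lemma computable_tagged [comp_intros]:
  assumes "computable f" shows "computable (\<lambda>A n. tagged d t (f A n))"
  unfolding tagged_def by (intro comp_intros assms)

text \<open>Every number codes a formula, so no code has to be checked for validity.\<close>

function decode_fml :: "nat \<Rightarrow> fml" where
  "decode_fml n =
    (if n mod 6 = 0 then Mem (pr1 (n div 6)) (pr2 (n div 6))
     else if n mod 6 = 1 then Equal (pr1 (n div 6)) (pr2 (n div 6))
     else if n mod 6 = 2 then In_X (n div 6)
     else if n mod 6 = 3 then Neg (decode_fml (n div 6))
     else if n mod 6 = 4 then Conj (decode_fml (pr1 (n div 6))) (decode_fml (pr2 (n div 6)))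
     else Exists (pr1 (n div 6)) (decode_fml (pr2 (n div 6))))"
  by auto
termination
  by (relation "measure id") (simp_all add: div_less_self pr_div_less)

declare decode_fml.simps [simp del]

lemma decode_fml_surj: "\<exists>n. decode_fml n = \<phi>"
proof (induction \<phi>)
  case (Mem i j)
  have "decode_fml (tagged 6 0 (prod_encode (i, j))) = Mem i j" by (subst decode_fml.simps) simp
  then show ?case by blast
next
  case (Equal i j)
  have "decode_fml (tagged 6 1 (prod_encode (i, j))) = Equal i j" by (subst decode_fml.simps) simp
  then show ?case by blast
next
  case (In_X i)
  have "decode_fml (tagged 6 2 i) = In_X i" by (subst decode_fml.simps) simp
  then show ?case by blast
next
  case (Neg \<phi>)
  then obtain n where "decode_fml n = \<phi>" by blast
  then have "decode_fml (tagged 6 3 n) = Neg \<phi>" by (subst decode_fml.simps) simp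
  then show ?case by blast
next
  case (Conj \<phi> \<psi>)
  then obtain m n where "decode_fml m = \<phi>" "decode_fml n = \<psi>" by blast
  then have "decode_fml (tagged 6 4 (prod_encode (m, n))) = Conj \<phi> \<psi>" by (subst decode_fml.simps) simp
  then show ?case by blast
next
  case (Exists i \<phi>)
  then obtain n where "decode_fml n = \<phi>" by blast
  then have "decode_fml (tagged 6 5 (prod_encode (i, n))) = Exists i \<phi>" by (subst decode_fml.simps) simp
  then show ?case by blast
qed

text \<open>
  Codes of assignments: \<open>2 * c\<close> is the constant assignment \<open>c\<close>, and \<open>update_code e i a\<close> changes
  the value at \<open>i\<close>.
\<close>

function assignment :: "nat \<Rightarrow> nat \<Rightarrow> nat" where
  "assignment e i =
    (if e mod 2 = 0 then e div 2
     else if pr1 (e div 2) = i then pr1 (pr2 (e div 2))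
     else assignment (pr2 (pr2 (e div 2))) i)"
  by auto
termination
  by (relation "measure fst") (simp_all add: pr_div_less)

declare assignment.simps [simp del]

definition update_code :: "nat \<Rightarrow> nat \<Rightarrow> nat \<Rightarrow> nat" where
  "update_code e i a = 2 * prod_encode (i, prod_encode (a, e)) + 1"

lemma assignment_const: "assignment (2 * c) = (\<lambda>_. c)"
  by (rule ext, subst assignment.simps) simp

lemma assignment_update: "assignment (update_code e i a) = (assignment e)(i := a)"
  by (rule ext, subst assignment.simps) (simp add: update_code_def)

lemma ex_assignment:
  assumes "finite I" shows "\<exists>e. \<forall>i\<in>I. assignment e i = u i"
  using assms
proof induction
  case (insert i I)
  then obtain e where "\<forall>i\<in>I. assignment e i = u i" by blast
  then have "\<forall>j\<in>insert i I. assignment (update_code e i (u i)) j = u j"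
    by (simp add: assignment_update)
  then show ?case by blast
qed simp

text \<open>The recursion of \<open>assignment\<close> as an iteration. A value that has been found
  is kept as a constant assignment, a fixed point, so surplus steps do no harm and the code itself
  can serve as the number of steps.\<close>

definition assignment_step :: "nat \<Rightarrow> nat \<Rightarrow> nat" where
  "assignment_step i e =
    (if e mod 2 = 0 then e
     else if pr1 (e div 2) = i then 2 * pr1 (pr2 (e div 2))
     else pr2 (pr2 (e div 2)))"

lemma assignment_funpow:
  assumes "e \<le> k" shows "assignment e i = (assignment_step i ^^ k) e div 2"
  using assms
proof (induction k arbitrary: e)
  case 0
  then show ?case by (simp add: assignment.simps)
next
  case (Suc k)
  have const: "(assignment_step i ^^ m) (2 * c) = 2 * c" for m c
    by (induction m) (simp_all add: assignment_step_def)
  consider (even) c where "e = 2 * c" | (hit) "e mod 2 = 1" "pr1 (e div 2) = i"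
    | (miss) "e mod 2 = 1" "pr1 (e div 2) \<noteq> i"
    by (cases "even e") (auto elim: evenE simp: odd_iff_mod_2_eq_one)
  then show ?case
  proof cases
    case even
    then show ?thesis by (simp only: const assignment_const)
  next
    case hit
    then have "(assignment_step i ^^ Suc k) e = 2 * pr1 (pr2 (e div 2))"
      unfolding funpow_Suc_right by (simp add: assignment_step_def const)
    then show ?thesis using hit by (simp add: assignment.simps[of e])
  next
    case miss
    let ?e = "pr2 (pr2 (e div 2))"
    have "?e < e"
      using miss by (simp add: pr_div_less)
    then have "assignment ?e i = (assignment_step i ^^ k) ?e div 2" using Suc by simp
    moreover have "(assignment_step i ^^ Suc k) e = (assignment_step i ^^ k) ?e"
      unfolding funpow_Suc_right using miss by (simp add: assignment_step_def)
    ultimately show ?thesis using miss by (simp add: assignment.simps[of e])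
  qed
qed

lemma computable_assignment [comp_intros]:
  assumes "computable e" "computable i"
  shows "computable (\<lambda>A n. assignment (e A n) (i A n))"
  unfolding assignment_funpow[OF order_refl] assignment_step_def
  by (intro comp_intros assms computable_comp[OF _ assms(2)])

text \<open>
  Atomic formulas with a variable whose value is not in \<open>N\<close> are false, so that parameters need
  not be checked and every number can serve as a name.
\<close>

primrec name_sat :: "(nat \<Rightarrow> hc) \<Rightarrow> nat set \<Rightarrow> hc set \<Rightarrow> (nat \<Rightarrow> nat) \<Rightarrow> fml \<Rightarrow> bool" where
  "name_sat V N X e (Mem i j) \<longleftrightarrow> e i \<in> N \<and> e j \<in> N \<and> V (e i) \<in> elts (V (e j))"
| "name_sat V N X e (Equal i j) \<longleftrightarrow> e i \<in> N \<and> e j \<in> N \<and> V (e i) = V (e j)"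
| "name_sat V N X e (In_X i) \<longleftrightarrow> e i \<in> N \<and> V (e i) \<in> X"
| "name_sat V N X e (Neg \<phi>) \<longleftrightarrow> \<not> name_sat V N X e \<phi>"
| "name_sat V N X e (Conj \<phi> \<psi>) \<longleftrightarrow> name_sat V N X e \<phi> \<and> name_sat V N X e \<psi>"
| "name_sat V N X e (Exists i \<phi>) \<longleftrightarrow> (\<exists>a\<in>N. name_sat V N X (e(i := a)) \<phi>)"

lemma name_sat_cong:
  "(\<And>a. a \<in> N \<Longrightarrow> V a = V' a) \<Longrightarrow> name_sat V N X e \<phi> = name_sat V' N X e \<phi>"
  by (induction \<phi> arbitrary: e) auto

lemma comp_fun_upd: "(\<lambda>j. f ((h(i := a)) j)) = (\<lambda>j. f (h j))(i := f a)"
  by auto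

lemma name_sat_eq_sat:
  "(\<And>i. i \<in> free_vars \<phi> \<Longrightarrow> e i \<in> N) \<Longrightarrow> name_sat V N X e \<phi> = sat (V ` N) X (\<lambda>i. V (e i)) \<phi>"
proof (induction \<phi> arbitrary: e)
  case (Exists i \<phi>)
  have "name_sat V N X (e(i := a)) \<phi> = sat (V ` N) X ((\<lambda>i. V (e i))(i := V a)) \<phi>" if "a \<in> N" for a
  proof -
    have "(e(i := a)) j \<in> N" if "j \<in> free_vars \<phi>" for j
      using Exists.prems[of j] that \<open>a \<in> N\<close> by simp
    from Exists.IH[OF this] show ?thesis by (simp only: comp_fun_upd[of V])
  qed
  then show ?case by auto
qed auto

definition false_fml :: fml where
  "false_fml = Exists 0 (Neg (Equal 0 0))"

text \<open>\<open>U\<close> holds the variables whose values are not admissible names. Making their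
  atoms false removes them from the free variables, so a name with bad parameters still denotes a
  definable set. \<open>In_X\<close> becomes false because \<open>X\<close> is empty at the lower
  levels.\<close>

primrec restrict_fml :: "fml \<Rightarrow> nat set \<Rightarrow> fml" where
  "restrict_fml (Mem i j) U = (if i \<in> U \<or> j \<in> U then false_fml else Mem i j)"
| "restrict_fml (Equal i j) U = (if i \<in> U \<or> j \<in> U then false_fml else Equal i j)"
| "restrict_fml (In_X i) U = false_fml"
| "restrict_fml (Neg \<phi>) U = Neg (restrict_fml \<phi> U)"
| "restrict_fml (Conj \<phi> \<psi>) U = Conj (restrict_fml \<phi> U) (restrict_fml \<psi> U)"
| "restrict_fml (Exists i \<phi>) U = Exists i (restrict_fml \<phi> (U - {i}))"

lemma X_free_restrict_fml: "X_free (restrict_fml \<phi> U)"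
  by (induction \<phi> arbitrary: U) (auto simp: false_fml_def)

lemma free_vars_restrict_fml: "free_vars (restrict_fml \<phi> U) \<subseteq> - U"
proof (induction \<phi> arbitrary: U)
  case (Exists j \<phi>)
  show ?case using Exists.IH[of "U - {j}"] by auto
qed (simp_all add: false_fml_def)

lemma name_sat_eq_sat_restrict:
  "name_sat V N {} e \<phi> = sat (V ` N) {} (\<lambda>i. V (e i)) (restrict_fml \<phi> {i. e i \<notin> N})"
proof (induction \<phi> arbitrary: e)
  case (Exists i \<phi>)
  have "name_sat V N {} (e(i := a)) \<phi>
     = sat (V ` N) {} ((\<lambda>i. V (e i))(i := V a)) (restrict_fml \<phi> ({j. e j \<notin> N} - {i}))" if "a \<in> N" for a
  proof -
    have "{j. (e(i := a)) j \<notin> N} = {j. e j \<notin> N} - {i}" using that by auto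
    then show ?thesis using Exists.IH[of "e(i := a)"] by (simp only: comp_fun_upd[of V])
  qed
  then show ?case by auto
qed (auto simp: false_fml_def)

text \<open>
  Every natural number is a name \<open>\<langle>\<gamma>, \<langle>\<phi>, e\<rangle>\<rangle>\<close>.  It denotes the set that \<open>\<phi>\<close> defines with the
  parameters \<open>e\<close> over the values of the names of level less than \<open>\<gamma>\<close>.
\<close>

abbreviation level :: "nat \<Rightarrow> nat" where "level c \<equiv> pr1 c"
abbreviation name_fml :: "nat \<Rightarrow> nat" where "name_fml c \<equiv> pr1 (pr2 c)"
abbreviation name_params :: "nat \<Rightarrow> nat" where "name_params c \<equiv> pr2 (pr2 c)"

definition names_below :: "omega_structure \<Rightarrow> nat \<Rightarrow> nat set" where
  "names_below R \<gamma> = {c. (level c, \<gamma>) \<in> R}"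

definition name_defines :: "omega_structure \<Rightarrow> (nat \<Rightarrow> hc) \<Rightarrow> nat \<Rightarrow> nat \<Rightarrow> bool" where
  "name_defines R V c a \<longleftrightarrow> a \<in> names_below R (level c) \<and>
     name_sat V (names_below R (level c)) {} ((assignment (name_params c))(0 := a)) (decode_fml (name_fml c))"

text \<open>Recursion on levels, which is well-founded in a copy of an ordinal. The chosen set
  exists because there are only countably many names.\<close>

definition name_val :: "omega_structure \<Rightarrow> nat \<Rightarrow> hc" where
  "name_val R = wfrec (inv_image R level) (\<lambda>V c. SOME x. elts x = V ` {a. name_defines R V c a})"

text \<open>The ordinals among the values of lower level make up the ordinal of \<open>n\<close>.
  The chosen formula code is a fixed number, so the map is computable; \<open>0\<close> is a
  constant assignment.\<close>

definition ordinal_name :: "nat \<Rightarrow> nat" where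
  "ordinal_name n = prod_encode (n, prod_encode (SOME m. decode_fml m = ordinal_fml, 0))"

locale ordinal_copy =
  fixes R :: omega_structure and \<alpha> :: hc and g :: "nat \<Rightarrow> hc"
  assumes ordinal: "is_ordinal \<alpha>"
    and bij: "bij_betw g UNIV (elts \<alpha>)"
    and less_iff: "(i, j) \<in> R \<longleftrightarrow> g i \<in> elts (g j)"
begin

abbreviation "V \<equiv> name_val R"
abbreviation "N \<equiv> names_below R"

lemma g_ordinal: "is_ordinal (g i)"
  using is_ordinal_elts[OF ordinal] bij by (auto simp: bij_betw_def)

lemma wf_R: "wf R"
proof (rule wf_subset)
  show "wf (inv_image {(x, y). x \<in> elts y} g)" using wf_elts by (rule wf_inv_image)
  show "R \<subseteq> inv_image {(x, y). x \<in> elts y} g" using less_iff by auto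
qed

lemma R_trans: "(i, j) \<in> R \<Longrightarrow> (j, k) \<in> R \<Longrightarrow> (i, k) \<in> R"
  using is_ordinal_trans[OF g_ordinal] unfolding less_iff by blast

lemma elts_g: "elts (g j) = g ` {i. (i, j) \<in> R}"
proof -
  have "g j \<in> elts \<alpha>" using bij by (auto simp: bij_betw_def)
  then have "elts (g j) \<subseteq> range g"
    using is_ordinal_trans[OF ordinal] bij by (auto simp: bij_betw_def)
  then show ?thesis unfolding less_iff by blast
qed

text \<open>Whether \<open>c\<close> admits \<open>a\<close> depends only on values of names of
  lower level, so cutting the recursion off there changes nothing.\<close>

lemma elts_name_val: "elts (V c) = V ` {a. name_defines R V c a}"
proof -
  let ?F = "\<lambda>V c. SOME x. elts x = V ` {a. name_defines R V c a}"
  let ?V = "cut V (inv_image R level) c"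
  have cut: "?V a = V a" if "a \<in> N (level c)" for a
    using that unfolding names_below_def by (simp add: cut_apply)
  have "name_defines R ?V c a \<longleftrightarrow> name_defines R V c a" for a
    unfolding name_defines_def by (rule conj_cong[OF refl name_sat_cong]) (rule cut)
  then have im: "?V ` {a. name_defines R ?V c a} = V ` {a. name_defines R V c a}"
    using cut by (force simp: name_defines_def)
  have "V c = ?F ?V c"
    unfolding name_val_def by (rule wfrec[OF wf_inv_image[OF wf_R]])
  then have "V c = (SOME x. elts x = V ` {a. name_defines R V c a})" unfolding im .
  moreover have "\<exists>x. elts x = V ` {a. name_defines R V c a}"
    by (rule ex_elts) simp
  ultimately show ?thesis by (metis (mono_tags, lifting) someI_ex)
qed

lemma elts_V_eq:
  assumes "\<And>a. a \<in> N (level c) \<Longrightarrow>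
    name_sat V (N (level c)) {} ((assignment (name_params c))(0 := a)) (decode_fml (name_fml c)) \<longleftrightarrow> P (V a)"
  shows "elts (V c) = {z \<in> V ` N (level c). P z}"
  unfolding elts_name_val name_defines_def using assms by auto

text \<open>Bad parameters are eliminated by \<open>restrict_fml\<close>. In the other direction,
  the finitely many parameters of a definition receive names, and \<open>ex_assignment\<close> codes
  these names.\<close>

lemma V_level: "V ` {c. level c = \<delta>} = Def (V ` N \<delta>)"
proof (intro equalityI subsetI)
  fix x assume "x \<in> V ` {c. level c = \<delta>}"
  then obtain c where c: "x = V c" "level c = \<delta>" by blast
  let ?e = "assignment (name_params c)" and ?\<phi> = "decode_fml (name_fml c)"
  \<comment> \<open>Variable \<open>0\<close> is taken out because the candidate element overwrites
    it.\<close>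
  define U where "U = {i. ?e i \<notin> N \<delta>} - {0}"
  have "name_sat V (N \<delta>) {} (?e(0 := a)) ?\<phi>
      = sat (V ` N \<delta>) {} ((\<lambda>i. V (?e i))(0 := V a)) (restrict_fml ?\<phi> U)" if "a \<in> N \<delta>" for a
  proof -
    have "{i. (?e(0 := a)) i \<notin> N \<delta>} = U" unfolding U_def using that by auto
    then show ?thesis
      using name_sat_eq_sat_restrict[of V "N \<delta>" "?e(0 := a)" ?\<phi>] by (simp only: comp_fun_upd[of V])
  qed
  then have "elts x = {z \<in> V ` N \<delta>. sat (V ` N \<delta>) {} ((\<lambda>i. V (?e i))(0 := z)) (restrict_fml ?\<phi> U)}"
    unfolding c(1) c(2)[symmetric] by (rule elts_V_eq)
  moreover have "V (?e i) \<in> V ` N \<delta>" if "i \<in> free_vars (restrict_fml ?\<phi> U)" "i \<noteq> 0" for i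
    using free_vars_restrict_fml[of ?\<phi> U] that unfolding U_def by blast
  ultimately show "x \<in> Def (V ` N \<delta>)"
    by (intro DefI[OF X_free_restrict_fml])
next
  fix x assume "x \<in> Def (V ` N \<delta>)"
  then obtain \<phi> e where e: "\<forall>i\<in>free_vars \<phi> - {0}. e i \<in> V ` N \<delta>"
    and x: "elts x = {a \<in> V ` N \<delta>. sat (V ` N \<delta>) {} (e(0 := a)) \<phi>}" unfolding Def_def by blast
  obtain u where u: "\<forall>i\<in>free_vars \<phi> - {0}. u i \<in> N \<delta> \<and> V (u i) = e i"
  proof -
    have "\<forall>i\<in>free_vars \<phi> - {0}. \<exists>b. b \<in> N \<delta> \<and> V b = e i" using e by force
    from bchoice[OF this] show ?thesis using that by blast
  qed
  obtain k where k: "\<forall>i\<in>free_vars \<phi> - {0}. assignment k i = u i"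
    using ex_assignment[of "free_vars \<phi> - {0}" u] finite_free_vars by blast
  obtain m where m: "decode_fml m = \<phi>" using decode_fml_surj by blast
  define c where "c = prod_encode (\<delta>, prod_encode (m, k))"
  have "name_sat V (N \<delta>) {} ((assignment k)(0 := a)) \<phi> = sat (V ` N \<delta>) {} (e(0 := V a)) \<phi>"
    if "a \<in> N \<delta>" for a
  proof -
    have "name_sat V (N \<delta>) {} ((assignment k)(0 := a)) \<phi>
        = sat (V ` N \<delta>) {} (\<lambda>i. V (((assignment k)(0 := a)) i)) \<phi>"
      by (rule name_sat_eq_sat) (use k u that in auto)
    also have "\<dots> = sat (V ` N \<delta>) {} (e(0 := V a)) \<phi>"
      by (rule sat_cong) (use k u in auto)
    finally show ?thesis .
  qed
  then have "elts (V c) = elts x"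
    using elts_V_eq[of c "\<lambda>z. sat (V ` N \<delta>) {} (e(0 := z)) \<phi>"] unfolding x c_def by (simp add: m)
  then have "x = V c" by (simp add: elts_inject)
  then show "x \<in> V ` {c. level c = \<delta>}" by (simp add: c_def)
qed

lemma V_below: "V ` N \<gamma> = L (g \<gamma>)"
proof (induction \<gamma> rule: wf_induct_rule[OF wf_R, case_names less])
  case (less \<gamma>)
  have "V ` N \<gamma> = (\<Union>\<delta>\<in>{\<delta>. (\<delta>, \<gamma>) \<in> R}. V ` {c. level c = \<delta>})"
    unfolding names_below_def by auto
  also have "\<dots> = (\<Union>\<delta>\<in>{\<delta>. (\<delta>, \<gamma>) \<in> R}. Def (L (g \<delta>)))"
    using less V_level by simp
  also have "\<dots> = L (g \<gamma>)" unfolding L_unfold[of "g \<gamma>"] elts_g by simp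
  finally show ?case .
qed

lemma range_V: "range V = L \<alpha>"
proof -
  have "range V = (\<Union>\<delta>. V ` {c. level c = \<delta>})" by auto
  also have "\<dots> = (\<Union>\<delta>. Def (L (g \<delta>)))" using V_level V_below by simp
  also have "\<dots> = L \<alpha>"
    unfolding L_unfold[of \<alpha>] bij_betw_imp_surj_on[OF bij, symmetric] by simp
  finally show ?thesis .
qed

lemma V_ordinal_name: "V (ordinal_name n) = g n"
proof -
  have dec: "decode_fml (SOME m. decode_fml m = ordinal_fml) = ordinal_fml"
    by (rule someI_ex[OF decode_fml_surj])
  have "name_sat V (N n) {} ((assignment 0)(0 := a)) ordinal_fml \<longleftrightarrow> is_ordinal (V a)"
    if "a \<in> N n" for a
  proof -
    have "name_sat V (N n) {} ((assignment 0)(0 := a)) ordinal_fml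
        = sat (V ` N n) {} (\<lambda>i. V (((assignment 0)(0 := a)) i)) ordinal_fml"
      by (rule name_sat_eq_sat) (use that ordinal_fml in auto)
    also have "\<dots> = is_ordinal (V a)"
      using that L_transitive[OF g_ordinal, of _ n]
      by (subst sat_ordinal_fml) (simp_all add: V_below[symmetric])
    finally show ?thesis .
  qed
  then have "elts (V (ordinal_name n)) = {z \<in> V ` N n. is_ordinal z}"
    using elts_V_eq[of "ordinal_name n" is_ordinal] unfolding ordinal_name_def by (simp add: dec)
  also have "\<dots> = elts (g n)" unfolding V_below by (rule ordinals_in_L[OF g_ordinal])
  finally show ?thesis by (simp add: elts_inject)
qed

end

section \<open>Truth in the constructible hierarchy as a system of equivalences\<close>

text \<open>Sentence codes carry their kind as residue modulo \<open>10\<close>. Residue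
  \<open>0\<close> has no clauses, so such sentences are false.\<close>

definition s_neg :: "nat \<Rightarrow> nat" where
  "s_neg q = tagged 10 1 q"
definition s_nand :: "nat \<Rightarrow> nat \<Rightarrow> nat" where
  "s_nand p q = tagged 10 2 (prod_encode (p, q))"
definition s_sat :: "nat \<Rightarrow> nat \<Rightarrow> nat \<Rightarrow> nat" where
  "s_sat \<beta> \<phi> e = tagged 10 3 (prod_encode (\<beta>, prod_encode (\<phi>, e)))"
definition s_mem :: "nat \<Rightarrow> nat \<Rightarrow> nat" where
  "s_mem x y = tagged 10 4 (prod_encode (x, y))"
text \<open>Non-inclusion rather than inclusion, as a sentence becomes true through a single
  witness.\<close>

definition s_nsub :: "nat \<Rightarrow> nat \<Rightarrow> nat" where
  "s_nsub x y = tagged 10 5 (prod_encode (x, y))"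
definition s_inX :: "nat \<Rightarrow> nat" where
  "s_inX x = tagged 10 6 x"
definition s_X :: "nat \<Rightarrow> nat" where
  "s_X x = tagged 10 7 x"
definition s_coX :: "nat \<Rightarrow> nat" where
  "s_coX x = tagged 10 8 x"
text \<open>Tests the uniqueness half of definability: \<open>\<psi>\<close> holds of the ordinal of
  some number other than \<open>n\<close>.\<close>

definition s_other :: "nat \<Rightarrow> nat \<Rightarrow> nat" where
  "s_other \<psi> n = tagged 10 9 (prod_encode (\<psi>, n))"

definition s_eq :: "nat \<Rightarrow> nat \<Rightarrow> nat" where
  "s_eq x y = s_neg (s_nand (s_neg (s_nsub x y)) (s_neg (s_nsub y x)))"

definition s_defines :: "nat \<Rightarrow> nat \<Rightarrow> nat" where
  "s_defines x a = s_sat (Suc (level x)) (name_fml x) (update_code (name_params x) 0 a)"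

text \<open>
  \<open>in_range A \<beta> x\<close> says that the name \<open>x\<close> belongs to the quantifier range coded by \<open>\<beta>\<close>: \<open>0\<close> codes
  the whole of \<open>L\<^sub>\<alpha>\<close>, and \<open>Suc \<gamma>\<close> codes the level of the element \<open>\<gamma>\<close> of the copy of \<open>\<alpha>\<close> with
  atomic diagram \<open>A\<close>.
\<close>

definition below :: "nat set \<Rightarrow> nat \<Rightarrow> nat \<Rightarrow> bool" where
  "below A i j \<longleftrightarrow> 2 * prod_encode (i, j) \<in> A"

definition in_range :: "nat set \<Rightarrow> nat \<Rightarrow> nat \<Rightarrow> bool" where
  "in_range A \<beta> x \<longleftrightarrow> \<beta> = 0 \<or> below A (level x) (\<beta> - 1)"

text \<open>
  A sentence \<open>q\<close> is to be true iff some \<open>r\<close> with \<open>clause A q k = Suc r\<close> is false.  The second-order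
  variable is left undetermined by letting \<open>s_X x\<close> and \<open>s_coX x\<close> negate each other; \<open>s_inX\<close> closes
  it under equality of the denoted sets.
\<close>

definition sat_clause :: "nat set \<Rightarrow> nat \<Rightarrow> nat \<Rightarrow> nat \<Rightarrow> nat \<Rightarrow> nat" where
  "sat_clause A \<beta> \<phi> e k =
    (if \<phi> mod 6 = 0 then
       if in_range A \<beta> (assignment e (pr1 (\<phi> div 6))) \<and> in_range A \<beta> (assignment e (pr2 (\<phi> div 6)))
       then Suc (s_neg (s_mem (assignment e (pr1 (\<phi> div 6))) (assignment e (pr2 (\<phi> div 6))))) else 0
     else if \<phi> mod 6 = 1 then
       if in_range A \<beta> (assignment e (pr1 (\<phi> div 6))) \<and> in_range A \<beta> (assignment e (pr2 (\<phi> div 6)))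
       then Suc (s_neg (s_eq (assignment e (pr1 (\<phi> div 6))) (assignment e (pr2 (\<phi> div 6))))) else 0
     else if \<phi> mod 6 = 2 then
       if \<beta> = 0 then Suc (s_neg (s_inX (assignment e (\<phi> div 6)))) else 0
     else if \<phi> mod 6 = 3 then Suc (s_sat \<beta> (\<phi> div 6) e)
     else if \<phi> mod 6 = 4 then
       Suc (s_nand (s_sat \<beta> (pr1 (\<phi> div 6)) e) (s_sat \<beta> (pr2 (\<phi> div 6)) e))
     else
       if in_range A \<beta> k
       then Suc (s_neg (s_sat \<beta> (pr2 (\<phi> div 6)) (update_code e (pr1 (\<phi> div 6)) k))) else 0)"

definition clause :: "nat set \<Rightarrow> nat \<Rightarrow> nat \<Rightarrow> nat" where
  "clause A q k =
    (if q mod 10 = 1 then Suc (q div 10)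
     else if q mod 10 = 2 then Suc (if k = 0 then pr1 (q div 10) else pr2 (q div 10))
     else if q mod 10 = 3 then
       sat_clause A (pr1 (q div 10)) (pr1 (pr2 (q div 10))) (pr2 (pr2 (q div 10))) k
     else if q mod 10 = 4 then
       if below A (level k) (level (pr2 (q div 10)))
       then Suc (s_nand (s_defines (pr2 (q div 10)) k) (s_eq (pr1 (q div 10)) k)) else 0
     else if q mod 10 = 5 then
       if below A (level k) (level (pr1 (q div 10)))
       then Suc (s_nand (s_defines (pr1 (q div 10)) k) (s_neg (s_mem k (pr2 (q div 10))))) else 0
     else if q mod 10 = 6 then Suc (s_nand (s_X k) (s_eq (q div 10) k))
     else if q mod 10 = 7 then Suc (s_coX (q div 10))
     else if q mod 10 = 8 then Suc (s_X (q div 10))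
     else if q mod 10 = 9 then
       if k \<noteq> pr2 (q div 10)
       then Suc (s_neg (s_sat 0 (pr1 (q div 10)) (2 * ordinal_name k))) else 0
     else 0)"

lemma clause_simps:
  "clause A (s_neg q) k = Suc q"
  "clause A (s_nand p q) k = Suc (if k = 0 then p else q)"
  "clause A (s_sat \<beta> \<phi> e) k = sat_clause A \<beta> \<phi> e k"
  "clause A (s_mem x y) k =
     (if below A (level k) (level y) then Suc (s_nand (s_defines y k) (s_eq x k)) else 0)"
  "clause A (s_nsub x y) k =
     (if below A (level k) (level x) then Suc (s_nand (s_defines x k) (s_neg (s_mem k y))) else 0)"
  "clause A (s_inX x) k = Suc (s_nand (s_X k) (s_eq x k))"
  "clause A (s_X x) k = Suc (s_coX x)"
  "clause A (s_coX x) k = Suc (s_X x)"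
  "clause A (s_other \<psi> n) k = (if k \<noteq> n then Suc (s_neg (s_sat 0 \<psi> (2 * ordinal_name k))) else 0)"
  by (simp_all add: clause_def s_neg_def[of q] s_nand_def[of p q] s_sat_def[of \<beta> \<phi> e] s_mem_def[of x y]
      s_nsub_def[of x y] s_inX_def[of x] s_X_def[of x] s_coX_def[of x] s_other_def[of \<psi> n])

lemma computable_clause:
  "computable (\<lambda>A m. clause A (pr1 m) (pr2 m))"
  unfolding clause_def sat_clause_def s_eq_def s_defines_def s_neg_def s_nand_def s_sat_def s_mem_def
    s_nsub_def s_inX_def s_X_def s_coX_def s_other_def below_def in_range_def update_code_def
    ordinal_name_def
  by (intro comp_intros)

lemma ex_guard:
  "(\<exists>k r. (if P k then Suc (f k) else 0) = Suc r \<and> \<not> v r) \<longleftrightarrow> (\<exists>k. P k \<and> \<not> v (f k))"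
  by (auto split: if_splits)

lemma below_atomic_diagram: "below (atomic_diagram R) i j \<longleftrightarrow> (i, j) \<in> R"
proof -
  have "2 * a \<noteq> Suc (2 * b)" for a b :: nat by presburger
  then show ?thesis unfolding below_def atomic_diagram_def by auto
qed

context ordinal_copy
begin

abbreviation "A \<equiv> atomic_diagram R"

definition range_names :: "nat \<Rightarrow> nat set" where
  "range_names \<beta> = {c. in_range A \<beta> c}"

lemma range_names: "range_names 0 = UNIV" "range_names (Suc \<gamma>) = N \<gamma>"
  by (auto simp: range_names_def in_range_def below_atomic_diagram names_below_def)

section \<open>Truth values forced by any model\<close>

context
  fixes v :: "nat \<Rightarrow> bool"
  assumes model: "model (clause A) v"
begin

lemma v_iff: "v q \<longleftrightarrow> (\<exists>k r. clause A q k = Suc r \<and> \<not> v r)"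
  using model unfolding model_def by blast

lemma v_neg: "v (s_neg q) \<longleftrightarrow> \<not> v q"
  unfolding v_iff[of "s_neg q"] clause_simps by simp

lemma v_nand: "v (s_nand p q) \<longleftrightarrow> \<not> (v p \<and> v q)"
proof -
  have "v (s_nand p q) \<longleftrightarrow> (\<exists>k::nat. \<not> v (if k = 0 then p else q))"
    unfolding v_iff[of "s_nand p q"] clause_simps by simp
  also have "\<dots> \<longleftrightarrow> \<not> (v p \<and> v q)" by (metis zero_neq_one)
  finally show ?thesis .
qed

lemma v_eq: "v (s_eq x y) \<longleftrightarrow> \<not> v (s_nsub x y) \<and> \<not> v (s_nsub y x)"
  unfolding s_eq_def v_neg v_nand by blast

lemma v_mem: "v (s_mem x y) \<longleftrightarrow> (\<exists>k. (level k, level y) \<in> R \<and> v (s_defines y k) \<and> v (s_eq x k))"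
proof -
  have "v (s_mem x y) \<longleftrightarrow> (\<exists>k. below A (level k) (level y) \<and> \<not> v (s_nand (s_defines y k) (s_eq x k)))"
    unfolding v_iff[of "s_mem x y"] clause_simps by (rule ex_guard)
  then show ?thesis unfolding v_nand below_atomic_diagram by simp
qed

lemma v_nsub: "v (s_nsub x y) \<longleftrightarrow> (\<exists>k. (level k, level x) \<in> R \<and> v (s_defines x k) \<and> \<not> v (s_mem k y))"
proof -
  have "v (s_nsub x y) \<longleftrightarrow>
      (\<exists>k. below A (level k) (level x) \<and> \<not> v (s_nand (s_defines x k) (s_neg (s_mem k y))))"
    unfolding v_iff[of "s_nsub x y"] clause_simps by (rule ex_guard)
  then show ?thesis unfolding v_nand v_neg below_atomic_diagram by simp
qed

lemma v_inX: "v (s_inX x) \<longleftrightarrow> (\<exists>k. v (s_X k) \<and> v (s_eq x k))"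
  unfolding v_iff[of "s_inX x"] clause_simps using v_nand by auto

lemma v_other: "v (s_other \<psi> n) \<longleftrightarrow> (\<exists>m. m \<noteq> n \<and> v (s_sat 0 \<psi> (2 * ordinal_name m)))"
proof -
  have "v (s_other \<psi> n) \<longleftrightarrow> (\<exists>k. k \<noteq> n \<and> \<not> v (s_neg (s_sat 0 \<psi> (2 * ordinal_name k))))"
    unfolding v_iff[of "s_other \<psi> n"] clause_simps by (rule ex_guard)
  then show ?thesis unfolding v_neg by simp
qed

text \<open>Tarski's recursion for one quantifier range, given that atoms are evaluated correctly.
  It serves the levels, where \<open>X\<close> is empty, and the whole structure alike.\<close>

lemma v_sat:
  assumes mem: "\<And>x y. x \<in> range_names \<beta> \<Longrightarrow> y \<in> range_names \<beta> \<Longrightarrow> v (s_mem x y) \<longleftrightarrow> V x \<in> elts (V y)"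
    and eq: "\<And>x y. x \<in> range_names \<beta> \<Longrightarrow> y \<in> range_names \<beta> \<Longrightarrow> v (s_eq x y) \<longleftrightarrow> V x = V y"
    and inX: "\<And>x. x \<in> range_names \<beta> \<Longrightarrow> \<beta> = 0 \<and> v (s_inX x) \<longleftrightarrow> V x \<in> X"
  shows "v (s_sat \<beta> \<phi> e) \<longleftrightarrow> name_sat V (range_names \<beta>) X (assignment e) (decode_fml \<phi>)"
proof (induction \<phi> arbitrary: e rule: decode_fml.induct)
  case (1 \<phi>)
  note clause = v_iff[of "s_sat \<beta> \<phi> e", unfolded clause_simps sat_clause_def]
  let ?c = "\<phi> div 6"
  have "\<phi> mod 6 < 6" by simp
  then consider "\<phi> mod 6 = 0" | "\<phi> mod 6 = 1" | "\<phi> mod 6 = 2" | "\<phi> mod 6 = 3" | "\<phi> mod 6 = 4" | "\<phi> mod 6 = 5"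
    by linarith
  then show ?case
  proof cases
    case t: 1
    have "v (s_sat \<beta> \<phi> e) \<longleftrightarrow> assignment e (pr1 ?c) \<in> range_names \<beta> \<and> assignment e (pr2 ?c) \<in> range_names \<beta>
        \<and> v (s_mem (assignment e (pr1 ?c)) (assignment e (pr2 ?c)))"
      unfolding clause using t by (auto simp: ex_guard v_neg range_names_def split: if_splits)
    also have "\<dots> \<longleftrightarrow> name_sat V (range_names \<beta>) X (assignment e) (decode_fml \<phi>)"
      unfolding decode_fml.simps[of \<phi>] using t mem by auto
    finally show ?thesis .
  next
    case t: 2
    have "v (s_sat \<beta> \<phi> e) \<longleftrightarrow> assignment e (pr1 ?c) \<in> range_names \<beta> \<and> assignment e (pr2 ?c) \<in> range_names \<beta>
        \<and> v (s_eq (assignment e (pr1 ?c)) (assignment e (pr2 ?c)))"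
      unfolding clause using t by (auto simp: ex_guard v_neg range_names_def split: if_splits)
    also have "\<dots> \<longleftrightarrow> name_sat V (range_names \<beta>) X (assignment e) (decode_fml \<phi>)"
      unfolding decode_fml.simps[of \<phi>] using t eq by auto
    finally show ?thesis .
  next
    case t: 3
    have "v (s_sat \<beta> \<phi> e) \<longleftrightarrow> \<beta> = 0 \<and> v (s_inX (assignment e ?c))"
      unfolding clause using t by (simp add: ex_guard v_neg)
    also have "\<dots> \<longleftrightarrow> assignment e ?c \<in> range_names \<beta> \<and> \<beta> = 0 \<and> v (s_inX (assignment e ?c))"
      using range_names by auto
    also have "\<dots> \<longleftrightarrow> name_sat V (range_names \<beta>) X (assignment e) (decode_fml \<phi>)"
      unfolding decode_fml.simps[of \<phi>] using t inX by auto
    finally show ?thesis .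
  next
    case t: 4
    have "v (s_sat \<beta> \<phi> e) \<longleftrightarrow> \<not> v (s_sat \<beta> ?c e)"
      unfolding clause using t by simp
    then show ?thesis unfolding decode_fml.simps[of \<phi>] using t "1.IH"(1) by simp
  next
    case t: 5
    have "v (s_sat \<beta> \<phi> e) \<longleftrightarrow> v (s_sat \<beta> (pr1 ?c) e) \<and> v (s_sat \<beta> (pr2 ?c) e)"
      unfolding clause using t by (simp add: v_nand)
    then show ?thesis unfolding decode_fml.simps[of \<phi>] using t "1.IH"(2,3) by simp
  next
    case t: 6
    have "v (s_sat \<beta> \<phi> e) \<longleftrightarrow> (\<exists>k\<in>range_names \<beta>. v (s_sat \<beta> (pr2 ?c) (update_code e (pr1 ?c) k)))"
      unfolding clause using t by (simp add: ex_guard v_neg range_names_def)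
    moreover have "v (s_sat \<beta> (pr2 ?c) (update_code e (pr1 ?c) k)) \<longleftrightarrow>
        name_sat V (range_names \<beta>) X ((assignment e)(pr1 ?c := k)) (decode_fml (pr2 ?c))" for k
      using "1.IH"(4)[of "update_code e (pr1 ?c) k"] t by (simp add: assignment_update fun_upd_def)
    ultimately show ?thesis
      unfolding decode_fml.simps[of \<phi>] using t by simp
  qed
qed

text \<open>Through non-inclusion and membership, \<open>s_eq c d\<close> refers to equalities
  between a name below \<open>c\<close> and a name below \<open>d\<close>. By symmetry of
  \<open>s_eq\<close> the former can be put first, so induction on the level of \<open>c\<close>
  alone suffices, with \<open>d\<close> arbitrary.\<close>

lemma v_mem_eq:
  assumes dfn: "\<And>c a. c \<in> M \<Longrightarrow> a \<in> N (level c) \<Longrightarrow> v (s_defines c a) \<longleftrightarrow> name_defines R V c a"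
    and down: "\<And>c a. c \<in> M \<Longrightarrow> a \<in> N (level c) \<Longrightarrow> a \<in> M"
    and x: "x \<in> M" and y: "y \<in> M"
  shows "v (s_mem x y) \<longleftrightarrow> V x \<in> elts (V y)" "v (s_eq x y) \<longleftrightarrow> V x = V y"
proof -
  have elts: "z \<in> elts (V c) \<longleftrightarrow> (\<exists>a\<in>N (level c). v (s_defines c a) \<and> z = V a)" if "c \<in> M" for c z
    unfolding elts_name_val using dfn[OF that] by (auto simp: name_defines_def)
  have mem: "v (s_mem a c) \<longleftrightarrow> V a \<in> elts (V c)"
    if "c \<in> M" "\<And>b. b \<in> N (level c) \<Longrightarrow> v (s_eq a b) \<longleftrightarrow> V a = V b" for a c
    unfolding elts[OF that(1)] v_mem using that(2) by (auto simp: names_below_def)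
  have nsub: "v (s_nsub c d) \<longleftrightarrow> \<not> elts (V c) \<subseteq> elts (V d)"
    if "c \<in> M" "\<And>a. a \<in> N (level c) \<Longrightarrow> v (s_mem a d) \<longleftrightarrow> V a \<in> elts (V d)" for c d
    unfolding subset_iff elts[OF that(1)] v_nsub using that(2) by (auto simp: names_below_def)
  have sym: "v (s_eq c d) = v (s_eq d c)" for c d unfolding v_eq by blast
  have eq: "v (s_eq c d) \<longleftrightarrow> V c = V d" if "c \<in> M" "d \<in> M" for c d
    using that
  proof (induction c arbitrary: d rule: wf_induct_rule[OF wf_inv_image[OF wf_R, of level], case_names less])
    case (less c)
    have IH: "v (s_eq a b) \<longleftrightarrow> V a = V b" if "a \<in> N (level c)" "b \<in> M" for a b
      using less.IH[of a b] that down[OF less.prems(1) that(1)] by (simp add: names_below_def)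
    have "v (s_nsub c d) \<longleftrightarrow> \<not> elts (V c) \<subseteq> elts (V d)"
      using nsub[OF less.prems(1)] mem[OF less.prems(2)] IH down[OF less.prems(2)] by blast
    moreover have "v (s_mem b c) \<longleftrightarrow> V b \<in> elts (V c)" if "b \<in> M" for b
      using mem[OF less.prems(1), of b] sym IH[OF _ that] by metis
    then have "v (s_nsub d c) \<longleftrightarrow> \<not> elts (V d) \<subseteq> elts (V c)"
      using nsub[OF less.prems(2)] down[OF less.prems(2)] by blast
    ultimately show ?case unfolding v_eq elts_inject[symmetric] by blast
  qed
  show "v (s_eq x y) \<longleftrightarrow> V x = V y" by (rule eq[OF x y])
  show "v (s_mem x y) \<longleftrightarrow> V x \<in> elts (V y)"
    by (rule mem[OF y]) (rule eq[OF x down[OF y]])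
qed

text \<open>Induction along the copy: names below \<gamma> are defined by satisfaction at smaller
  levels, so their defining sentences already have the right values.\<close>

lemma v_level_sat:
  "v (s_sat (Suc \<gamma>) \<phi> e) \<longleftrightarrow> name_sat V (N \<gamma>) {} (assignment e) (decode_fml \<phi>)"
proof (induction \<gamma> arbitrary: \<phi> e rule: wf_induct_rule[OF wf_R, case_names less])
  case (less \<gamma>)
  have dfn: "v (s_defines c a) \<longleftrightarrow> name_defines R V c a"
    if "c \<in> N \<gamma>" "a \<in> N (level c)" for c a
    unfolding s_defines_def name_defines_def using less[of "level c"] that
    by (simp add: names_below_def assignment_update)
  have down: "a \<in> N \<gamma>" if "c \<in> N \<gamma>" "a \<in> N (level c)" for c a
    using that R_trans unfolding names_below_def by blast
  show ?case unfolding range_names(2)[symmetric]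
    by (rule v_sat) (use v_mem_eq[of "N \<gamma>", OF dfn down] in \<open>simp_all add: range_names\<close>)
qed

lemma v_top_sat:
  "v (s_sat 0 \<phi> e) \<longleftrightarrow> name_sat V UNIV {V x | x. v (s_X x)} (assignment e) (decode_fml \<phi>)"
proof -
  have dfn: "v (s_defines c a) \<longleftrightarrow> name_defines R V c a" if "a \<in> N (level c)" for c a
    unfolding s_defines_def name_defines_def v_level_sat using that by (simp add: assignment_update)
  have mem_eq: "v (s_mem x y) \<longleftrightarrow> V x \<in> elts (V y)" "v (s_eq x y) \<longleftrightarrow> V x = V y" for x y
    using v_mem_eq[of UNIV] dfn by simp_all
  show ?thesis unfolding range_names(1)[symmetric]
    by (rule v_sat) (auto simp: mem_eq v_inX)
qed

end

section \<open>The truth assignment given by a second-order set\<close>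

function truth :: "hc set \<Rightarrow> nat \<Rightarrow> bool" where
  "truth X q \<longleftrightarrow>
    (if q mod 10 = 1 then \<not> truth X (q div 10)
     else if q mod 10 = 2 then \<not> (truth X (pr1 (q div 10)) \<and> truth X (pr2 (q div 10)))
     else if q mod 10 = 3 then
       name_sat V (range_names (pr1 (q div 10))) (if pr1 (q div 10) = 0 then X else {})
         (assignment (pr2 (pr2 (q div 10)))) (decode_fml (pr1 (pr2 (q div 10))))
     else if q mod 10 = 4 then V (pr1 (q div 10)) \<in> elts (V (pr2 (q div 10)))
     else if q mod 10 = 5 then \<not> elts (V (pr1 (q div 10))) \<subseteq> elts (V (pr2 (q div 10)))
     else if q mod 10 = 6 then V (q div 10) \<in> X
     else if q mod 10 = 7 then V (q div 10) \<in> X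
     else if q mod 10 = 8 then V (q div 10) \<notin> X
     else if q mod 10 = 9 then
       \<exists>k. k \<noteq> pr2 (q div 10) \<and>
         name_sat V UNIV X (assignment (2 * ordinal_name k)) (decode_fml (pr1 (q div 10)))
     else False)"
  by auto
termination
  by (relation "measure snd") (simp_all add: div_less_self pr_div_less)

declare truth.simps [simp del]

lemma truth_simps:
  "truth X (s_neg q) \<longleftrightarrow> \<not> truth X q"
  "truth X (s_nand p q) \<longleftrightarrow> \<not> (truth X p \<and> truth X q)"
  "truth X (s_sat \<beta> \<phi> e) \<longleftrightarrow>
     name_sat V (range_names \<beta>) (if \<beta> = 0 then X else {}) (assignment e) (decode_fml \<phi>)"
  "truth X (s_mem x y) \<longleftrightarrow> V x \<in> elts (V y)"
  "truth X (s_nsub x y) \<longleftrightarrow> \<not> elts (V x) \<subseteq> elts (V y)"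
  "truth X (s_inX x) \<longleftrightarrow> V x \<in> X"
  "truth X (s_X x) \<longleftrightarrow> V x \<in> X"
  "truth X (s_coX x) \<longleftrightarrow> V x \<notin> X"
  "truth X (s_other \<psi> n) \<longleftrightarrow>
     (\<exists>k. k \<noteq> n \<and> name_sat V UNIV X (assignment (2 * ordinal_name k)) (decode_fml \<psi>))"
  unfolding s_neg_def s_nand_def s_sat_def s_mem_def s_nsub_def s_inX_def s_X_def s_coX_def
    s_other_def
  by (subst truth.simps, simp)+

lemma truth_eq: "truth X (s_eq x y) \<longleftrightarrow> V x = V y"
  unfolding s_eq_def truth_simps elts_inject[symmetric] by blast

lemma truth_sat_clause:
  "truth X (s_sat \<beta> \<phi> e) \<longleftrightarrow> (\<exists>k r. sat_clause A \<beta> \<phi> e k = Suc r \<and> \<not> truth X r)"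
proof -
  have "\<phi> mod 6 < 6" by simp
  then consider "\<phi> mod 6 = 0" | "\<phi> mod 6 = 1" | "\<phi> mod 6 = 2" | "\<phi> mod 6 = 3" | "\<phi> mod 6 = 4" | "\<phi> mod 6 = 5"
    by linarith
  then show ?thesis
  proof cases
    case 6
    have upd: "name_sat V M Y (assignment (update_code e i k)) \<psi> = name_sat V M Y ((assignment e)(i := k)) \<psi>"
      for M Y i k \<psi> by (simp add: assignment_update fun_upd_def)
    from 6 show ?thesis
      unfolding truth_simps decode_fml.simps[of \<phi>] sat_clause_def
      by (simp add: ex_guard truth_simps upd) (simp add: range_names_def Bex_def)
  qed (simp_all add: truth_simps decode_fml.simps[of \<phi>] sat_clause_def ex_guard truth_eq,
      auto simp: range_names_def in_range_def)
qed

text \<open>The clauses hold kind by kind; witnesses are found because every element of the value of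
  a name is the value of a name of lower level.\<close>

lemma model_truth:
  assumes "X \<subseteq> range V" shows "model (clause A) (truth X)"
  unfolding model_def
proof
  fix q :: nat
  let ?c = "q div 10"
  have "q mod 10 = 0 \<or> q mod 10 = 1 \<or> q mod 10 = 2 \<or> q mod 10 = 3 \<or> q mod 10 = 4 \<or>
      q mod 10 = 5 \<or> q mod 10 = 6 \<or> q mod 10 = 7 \<or> q mod 10 = 8 \<or> q mod 10 = 9"
    by presburger
  then consider "q mod 10 = 0" | "q mod 10 = 1" | "q mod 10 = 2" | "q mod 10 = 3" | "q mod 10 = 4"
    | "q mod 10 = 5" | "q mod 10 = 6" | "q mod 10 = 7" | "q mod 10 = 8" | "q mod 10 = 9"
    by argo
  moreover have q: "q = tagged 10 (q mod 10) ?c" by (simp add: tagged_def)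
  moreover have c: "?c = prod_encode (pr1 ?c, pr2 ?c)" by simp
  have dfn: "truth X (s_defines c a) \<longleftrightarrow> name_defines R V c a" if "a \<in> N (level c)" for c a
    unfolding s_defines_def truth_simps range_names name_defines_def
    using that by (simp add: assignment_update)
  have elts: "z \<in> elts (V c) \<longleftrightarrow> (\<exists>a. (level a, level c) \<in> R \<and> truth X (s_defines c a) \<and> z = V a)" for c z
    unfolding elts_name_val using dfn[of _ c] by (auto simp: name_defines_def names_below_def)
  ultimately show "truth X q \<longleftrightarrow> (\<exists>k r. clause A q k = Suc r \<and> \<not> truth X r)"
  proof cases
    case 1
    then show ?thesis by (simp add: truth.simps[of X q] clause_def)
  next
    case 2
    then have "q = s_neg ?c" using q by (simp add: s_neg_def)
    then obtain p where "q = s_neg p" by blast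
    then show ?thesis by (simp add: clause_simps truth_simps)
  next
    case 3
    then have "q = s_nand (pr1 ?c) (pr2 ?c)" using q by (simp add: s_nand_def)
    then obtain p r where "q = s_nand p r" by blast
    then show ?thesis by (auto simp: clause_simps truth_simps split: if_splits)
  next
    case 4
    then have "q = s_sat (pr1 ?c) (pr1 (pr2 ?c)) (pr2 (pr2 ?c))" using q by (simp add: s_sat_def)
    then obtain \<beta> \<phi> e where "q = s_sat \<beta> \<phi> e" by blast
    then show ?thesis by (simp add: clause_simps truth_sat_clause)
  next
    case 5
    then have "q = s_mem (pr1 ?c) (pr2 ?c)" using q by (simp add: s_mem_def)
    then obtain x y where "q = s_mem x y" by blast
    then show ?thesis
      by (simp add: clause_simps ex_guard truth_simps truth_eq below_atomic_diagram elts)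
  next
    case 6
    then have "q = s_nsub (pr1 ?c) (pr2 ?c)" using q by (simp add: s_nsub_def)
    then obtain x y where "q = s_nsub x y" by blast
    moreover have "truth X (s_nsub x y) \<longleftrightarrow>
        (\<exists>k. (level k, level x) \<in> R \<and> truth X (s_defines x k) \<and> V k \<notin> elts (V y))"
      unfolding truth_simps subset_iff elts[of _ x] by blast
    ultimately show ?thesis
      by (simp add: clause_simps ex_guard truth_simps(1,2,4) below_atomic_diagram)
  next
    case 7
    then have "q = s_inX ?c" using q by (simp add: s_inX_def)
    then obtain x where "q = s_inX x" by blast
    moreover have "V x \<in> X \<longleftrightarrow> (\<exists>k. V k \<in> X \<and> V x = V k)" by auto
    ultimately show ?thesis by (simp add: clause_simps truth_simps truth_eq)
  next
    case 8
    then have "q = s_X ?c" using q by (simp add: s_X_def)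
    then obtain x where "q = s_X x" by blast
    then show ?thesis by (simp add: clause_simps truth_simps)
  next
    case 9
    then have "q = s_coX ?c" using q by (simp add: s_coX_def)
    then obtain x where "q = s_coX x" by blast
    then show ?thesis by (simp add: clause_simps truth_simps)
  next
    case 10
    then have "q = s_other (pr1 ?c) (pr2 ?c)" using q by (simp add: s_other_def)
    then obtain \<psi> n where "q = s_other \<psi> n" by blast
    then show ?thesis by (simp add: clause_simps ex_guard truth_simps range_names)
  qed
qed

lemma name_sat_ordinal_name:
  "name_sat V UNIV X (assignment (2 * ordinal_name n)) \<phi> \<longleftrightarrow> sat (L \<alpha>) X (\<lambda>_. g n) \<phi>"
  by (simp add: name_sat_eq_sat assignment_const range_V V_ordinal_name)

lemma v_top_sat_ordinal_name:
  assumes "model (clause A) v"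
  shows "v (s_sat 0 \<psi> (2 * ordinal_name n)) \<longleftrightarrow>
    sat (L \<alpha>) {V x | x. v (s_X x)} (\<lambda>_. g n) (decode_fml \<psi>)"
  unfolding v_top_sat[OF assms] name_sat_ordinal_name ..

text \<open>A model yields the set of values of the names with true \<open>s_X\<close>; conversely,
  \<open>truth X\<close> is a model for every \<open>X\<close>. So the second-order quantifier
  becomes the existence of a model.\<close>

lemma ex_model_sat:
  "(\<exists>v. model (clause A) v \<and> v (s_sat 0 \<psi> (2 * ordinal_name n))) \<longleftrightarrow>
    sat_Sigma11 (L \<alpha>) (decode_fml \<psi>) (g n)"
proof
  assume "\<exists>v. model (clause A) v \<and> v (s_sat 0 \<psi> (2 * ordinal_name n))"
  then obtain v where "sat (L \<alpha>) {V x | x. v (s_X x)} (\<lambda>_. g n) (decode_fml \<psi>)"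
    using v_top_sat_ordinal_name by blast
  moreover have "{V x | x. v (s_X x)} \<subseteq> L \<alpha>" unfolding range_V[symmetric] by blast
  ultimately show "sat_Sigma11 (L \<alpha>) (decode_fml \<psi>) (g n)" unfolding sat_Sigma11_def by blast
next
  assume "sat_Sigma11 (L \<alpha>) (decode_fml \<psi>) (g n)"
  then obtain X where X: "X \<subseteq> range V" "sat (L \<alpha>) X (\<lambda>_. g n) (decode_fml \<psi>)"
    unfolding sat_Sigma11_def range_V by blast
  have "truth X (s_sat 0 \<psi> (2 * ordinal_name n))"
    unfolding truth_simps range_names using X(2) by (simp add: name_sat_ordinal_name)
  then show "\<exists>v. model (clause A) v \<and> v (s_sat 0 \<psi> (2 * ordinal_name n))"
    using model_truth[OF X(1)] by blast
qed

lemma ex_model_other: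
  "(\<exists>v. model (clause A) v \<and> v (s_other \<psi> n)) \<longleftrightarrow>
    (\<exists>m. m \<noteq> n \<and> sat_Sigma11 (L \<alpha>) (decode_fml \<psi>) (g m))"
  unfolding ex_model_sat[symmetric] using v_other by blast

end

section \<open>The isomorphism\<close>

lemma join_iff: "2 * a \<in> join B C \<longleftrightarrow> a \<in> B" "2 * a + 1 \<in> join B C \<longleftrightarrow> a \<in> C"
proof -
  have "2 * a \<noteq> Suc (2 * b)" "Suc (2 * b) \<noteq> 2 * a" for a b :: nat by presburger+
  then show "2 * a \<in> join B C \<longleftrightarrow> a \<in> B" "2 * a + 1 \<in> join B C \<longleftrightarrow> a \<in> C"
    unfolding join_def by auto
qed

text \<open>Unbounded search: \<open>P\<close> is decided uniformly, while success is required for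
  the oracle \<open>B\<close>.\<close>

lemma computable_from_search:
  assumes "decidable (\<lambda>B m. P B (pr1 m) (pr2 m))" "computable f" "\<And>n. \<exists>k. P B n k"
  shows "computable_from (\<lambda>n. f B (LEAST k. P B n k)) B"
proof -
  \<comment> \<open>\<open>Mu\<close> stops at the value \<open>0\<close>, so \<open>0\<close>
    stands for success.\<close>
  have "computable (\<lambda>B m. if P B (pr1 m) (pr2 m) then 0 else 1)"
    by (intro comp_intros assms)
  then obtain p where p: "\<And>m. run B p m = Some (if P B (pr1 m) (pr2 m) then 0 else 1)"
    unfolding computable_def by blast
  obtain q where q: "\<And>m. run B q m = Some (f B m)" using assms(2) unfolding computable_def by blast
  have "run B (Mu p) n = Some (LEAST k. P B n k)" for n
  proof -
    have "P B n (LEAST k. P B n k)" by (rule LeastI_ex[OF assms(3)])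
    moreover have "\<forall>k<LEAST k. P B n k. \<not> P B n k" using not_less_Least by blast
    ultimately have "\<exists>m. P B n m \<and> (\<forall>k<m. \<not> P B n k)" by blast
    then show ?thesis by (simp add: p) blast
  qed
  then have "run B (Comp q (Mu p)) n = Some (f B (LEAST k. P B n k))" for n by (simp add: q)
  then show ?thesis unfolding computable_from_def by blast
qed

theorem theorem3p5:
  fixes \<alpha> :: hc
  assumes "is_ordinal \<alpha>"
    and "Sigma11_pd \<alpha>"
  shows "clarifies Kleene_O {R. isomorphic_to_ordinal R \<alpha>}"
  unfolding clarifies_def
proof (intro ballI)
  fix R S assume "R \<in> {R. isomorphic_to_ordinal R \<alpha>}" "S \<in> {R. isomorphic_to_ordinal R \<alpha>}"
  then obtain g g' where g: "bij_betw g UNIV (elts \<alpha>)" "\<And>i j. (i, j) \<in> R \<longleftrightarrow> g i \<in> elts (g j)"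
    and g': "bij_betw g' UNIV (elts \<alpha>)" "\<And>i j. (i, j) \<in> S \<longleftrightarrow> g' i \<in> elts (g' j)"
    unfolding isomorphic_to_ordinal_def by blast
  interpret R: ordinal_copy R \<alpha> g by unfold_locales (use assms(1) g in auto)
  interpret S: ordinal_copy S \<alpha> g' by unfold_locales (use assms(1) g' in auto)
  obtain h where h: "computable (\<lambda>A. h)"
    "\<And>A p. h p \<in> Kleene_O A \<longleftrightarrow> \<not> (\<exists>v. model (clause A) v \<and> v p)"
    using ex_reduction_to_Kleene_O[OF computable_clause] by blast
  define B where "B = join (Kleene_O (atomic_diagram R)) (Kleene_O (atomic_diagram S))"
  \<comment> \<open>\<open>k\<close> codes a formula and an element of \<open>S\<close>. Even
    questions go to the half of \<open>R\<close>, odd ones to the half of \<open>S\<close>; a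
    negative answer means that a model exists, a positive one that none does.\<close>
  define P where "P C n k \<longleftrightarrow> 2 * h (s_sat 0 (pr1 k) (2 * ordinal_name n)) \<notin> C \<and>
     2 * h (s_other (pr1 k) n) \<in> C \<and> 2 * h (s_sat 0 (pr1 k) (2 * ordinal_name (pr2 k))) + 1 \<notin> C"
    for C n k
  let ?\<Phi> = "\<lambda>\<psi>. sat_Sigma11 (L \<alpha>) (decode_fml \<psi>)"
  have P: "P B n k \<longleftrightarrow> ?\<Phi> (pr1 k) (g n) \<and> \<not> (\<exists>m. m \<noteq> n \<and> ?\<Phi> (pr1 k) (g m)) \<and> ?\<Phi> (pr1 k) (g' (pr2 k))" for n k
    unfolding P_def B_def join_iff h(2) R.ex_model_sat R.ex_model_other S.ex_model_sat by blast
  have range: "range g = elts \<alpha>" "range g' = elts \<alpha>"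
    using g(1) g'(1) by (auto simp: bij_betw_def)
  have ex: "\<exists>k. P B n k" for n
  proof -
    \<comment> \<open>Ordinals below \<alpha> belong to \<open>L \<alpha>\<close>, so the hypothesis
      supplies a formula that defines \<open>g n\<close>.\<close>
    have "g n \<in> L \<alpha>" using R.V_ordinal_name[of n] R.range_V by (metis rangeI)
    then obtain \<psi>' where \<psi>': "{x \<in> L \<alpha>. sat_Sigma11 (L \<alpha>) \<psi>' x} = {g n}"
      using assms(2) unfolding Sigma11_pd_def by blast
    obtain \<psi> where \<psi>: "decode_fml \<psi> = \<psi>'" using decode_fml_surj by blast
    have "g m \<in> L \<alpha>" for m using R.V_ordinal_name[of m] R.range_V by (metis rangeI)
    then have unique: "?\<Phi> \<psi> (g m) \<longleftrightarrow> g m = g n" for m using \<psi>' \<psi> by blast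
    obtain m where m: "g' m = g n" using range by (metis rangeE rangeI)
    have "inj g" using g(1) by (simp add: bij_betw_def)
    then have "P B n (prod_encode (\<psi>, m))" unfolding P using unique m by (auto dest: injD)
    then show ?thesis by blast
  qed
  define f where "f n = pr2 (LEAST k. P B n k)" for n
  have f: "g' (f n) = g n" for n
  proof -
    obtain k where k: "P B n k" "f n = pr2 k"
      unfolding f_def using LeastI_ex[OF ex] by blast
    \<comment> \<open>The ordinal numbered \<open>f n\<close> in \<open>S\<close> has some number
      \<open>m\<close> in \<open>R\<close>; as the formula found holds of it, uniqueness forces
      \<open>m = n\<close>.\<close>
    obtain m where m: "g' (f n) = g m" using range by (metis rangeE rangeI)
    then have "m = n" using k unfolding P by auto
    then show ?thesis using m by simp
  qed
  have "f = inv g' \<circ> g"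
  proof
    have "inj g'" using g'(1) by (simp add: bij_betw_def)
    then show "f n = (inv g' \<circ> g) n" for n unfolding comp_def f[symmetric] by simp
  qed
  moreover have "bij_betw (inv g') (elts \<alpha>) UNIV" by (rule bij_betw_inv_into[OF g'(1)])
  ultimately have "bij f" by (simp only: bij_betw_trans[OF g(1)])
  then have "isomorphism f R S" unfolding isomorphism_def g(2) g'(2) f by simp
  moreover have "decidable (\<lambda>C m. P C (pr1 m) (pr2 m))"
    unfolding P_def s_sat_def s_other_def ordinal_name_def
    by (intro comp_intros computable_comp[where h = "\<lambda>A. h", OF _ h(1)])
  then have "computable_from f B"
    unfolding f_def
    by (rule computable_from_search[where P = P and f = "\<lambda>C k. pr2 k"])
      (intro comp_intros, rule ex)
  ultimately show "\<exists>f. isomorphism f R S \<and>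
      computable_from f (join (Kleene_O (atomic_diagram R)) (Kleene_O (atomic_diagram S)))"
    unfolding B_def by blast
qed

end
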